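(* Let $n\ge 2$ and consider an equation $\sum_{i,j=1}^n f_{ij}({\bf p})u_{x_ix_j}=0$ for $u(x_1,\dots,x_n)$, where $(f_{ij})$ is a symmetric nondegenerate matrix of functions of ${\bf p}=(p^1,\dots,p^n)$, $p^i=u_{x_i}$. The following are equivalent: (1) the equation is linearizable by a transformation from the equivalence group $SL(n+1,\mathbb{R})$; (2) the equation is Lagrangian with Lagrangian density $g=Q({\bf p})/l({\bf p})$, where $Q$ is a (not necessarily homogeneous) quadratic polynomial and $l$ a (not necessarily homogeneous) linear polynomial in $p^1,\dots,p^n$; (3) the conformal structure $f_{ij}dp^idp^j$ possesses a complex (a $(2n-3)$-parameter family) of null lines whose quadratic cones all pass through a fixed quadric contained in a fixed hyperplane. For $n=3$ these conditions are equivalent to the requirement that the null lines form a quadratic line complex with Segre symbol $[(222)]$.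
   Context: The equivalence group consists of the transformations $\tilde{\bf x}=C{\bf x}+bu$, $\tilde u=c{\bf x}+\beta u$ (with $C$ an $n\times n$ matrix, $b$ a column vector, $c$ a row vector, $\beta$ a scalar, the whole $(n+1)\times(n+1)$ matrix in $SL(n+1,\mathbb{R})$); they act on ${\bf p}$ (a row vector) projectively by $\tilde{\bf p}=\kappa{\bf p}C^{-1}+cC^{-1}$, $\kappa=1/\det(C+b{\bf p})$, and on the coefficient matrix $F=(f_{ij})$ by $\tilde F=\kappa^{-1}(C+b{\bf p})F(C+b{\bf p})^t$. Thus ${\bf p}$ are affine coordinates on projective space $P^n$ and $f_{ij}dp^idp^j$ is a conformal structure on it (the equation is considered up to a nonzero factor). Linearizable means the transformed coefficient matrix is proportional to a constant matrix. Lagrangian with density $g({\bf p})$ means $(f_{ij})$ is proportional to the Hessian matrix $(\partial^2 g/\partial p^i\partial p^j)$, i.e. the equation is the Euler–Lagrange equation of $\int g(\nabla u)\,d{\bf x}$. A null line is a straight line in $P^n$ whose tangent direction is null for $f_{ij}dp^idp^j$ at each of its points; for a complex of null lines, the lines through a point form the null cone at that point. *)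

theory Defs
  imports "HOL-Analysis.Analysis"
begin

section \<open>Homogeneous coordinates on P^n (index type 'n option, None = the u-slot)\<close>

definition hom :: "real^'n \<Rightarrow> real^('n option)" where
  "hom p = (\<chi> i. case i of None \<Rightarrow> 1 | Some k \<Rightarrow> p $ k)"

definition dirv :: "real^'n \<Rightarrow> real^('n option)" where
  "dirv v = (\<chi> i. case i of None \<Rightarrow> 0 | Some k \<Rightarrow> v $ k)"

text \<open>M = [[C, b],[c, beta]] in SL(n+1,R) acting on (x,u); the matrix C + b p.\<close>
definition Cbp :: "real^('n option)^('n option) \<Rightarrow> real^'n \<Rightarrow> real^'n^'n" where
  "Cbp M p = (\<chi> i j. M $ Some i $ Some j + M $ Some i $ None * p $ j)"

text \<open>Transformed coefficient matrix is kappa^-1 (C+bp) F (C+bp)^t; linearizable means it is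
  proportional to a constant matrix, the transformation being defined (det(C+bp) ~= 0) on U.\<close>
definition linearizable :: "(real^'n) set \<Rightarrow> (real^'n \<Rightarrow> real^'n^'n) \<Rightarrow> bool" where
  "linearizable U F \<longleftrightarrow>
     (\<exists>M A. det M = 1 \<and>
        (\<forall>p\<in>U. det (Cbp M p) \<noteq> 0 \<and>
          (\<exists>\<mu>. (Cbp M p ** F p ** transpose (Cbp M p)) = \<mu> *\<^sub>R A)))"

definition partial :: "'n \<Rightarrow> (real^'n \<Rightarrow> real) \<Rightarrow> real^'n \<Rightarrow> real" where
  "partial i g p = deriv (\<lambda>t. g (p + t *\<^sub>R axis i 1)) 0"

definition hessian :: "(real^'n \<Rightarrow> real) \<Rightarrow> real^'n \<Rightarrow> real^'n^'n" where
  "hessian g p = (\<chi> i j. partial i (partial j g) p)"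

definition lagrangian :: "(real^'n) set \<Rightarrow> (real^'n \<Rightarrow> real^'n^'n) \<Rightarrow> (real^'n \<Rightarrow> real) \<Rightarrow> bool" where
  "lagrangian U F g \<longleftrightarrow> (\<forall>p\<in>U. \<exists>\<mu>. F p = \<mu> *\<^sub>R hessian g p)"

definition lagrangian_QL :: "(real^'n) set \<Rightarrow> (real^'n \<Rightarrow> real^'n^'n) \<Rightarrow> bool" where
  "lagrangian_QL U F \<longleftrightarrow>
     (\<exists>(Aq::real^'n^'n) (bq::real^'n) (c0::real) (d::real^'n) (e::real).
        (\<forall>p\<in>U. d \<bullet> p + e \<noteq> 0) \<and>
        lagrangian U F (\<lambda>p. (p \<bullet> (Aq *v p) + bq \<bullet> p + c0) / (d \<bullet> p + e)))"

definition proj_hyp :: "real^('n option) \<Rightarrow> real^'n \<Rightarrow> real^'n \<Rightarrow> real^('n option)" where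
  "proj_hyp h p v = dirv v - ((h \<bullet> dirv v) / (h \<bullet> hom p)) *\<^sub>R hom p"

text \<open>At every point p of U the null cone of f_ij dp^i dp^j (the cone of the null lines
  through p) is the cone with vertex p over the quadric S.X.X = 0 inside the hyperplane h.X = 0.\<close>
definition cones_through_quadric :: "(real^'n) set \<Rightarrow> (real^'n \<Rightarrow> real^'n^'n) \<Rightarrow> bool" where
  "cones_through_quadric U F \<longleftrightarrow>
     (\<exists>(h::real^('n option)) (S::real^('n option)^('n option)).
        h \<noteq> 0 \<and>
        (\<forall>p\<in>U. h \<bullet> hom p \<noteq> 0 \<and>
           (\<exists>\<mu>. \<mu> \<noteq> 0 \<and>
              (\<forall>v. v \<bullet> (F p *v v) = \<mu> * (proj_hyp h p v \<bullet> (S *v proj_hyp h p v))))))"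

definition wedge :: "real^'m \<Rightarrow> real^'m \<Rightarrow> real^'m^'m" where
  "wedge P V = (\<chi> i j. P $ i * V $ j - P $ j * V $ i)"

definition bivectors :: "(real^'m^'m) set" where
  "bivectors = {B. transpose B = - B}"

definition qf :: "('m::finite \<Rightarrow> 'm \<Rightarrow> 'm \<Rightarrow> 'm \<Rightarrow> real) \<Rightarrow> real^'m^'m \<Rightarrow> real" where
  "qf \<Phi> B = (\<Sum>i\<in>UNIV. \<Sum>j\<in>UNIV. \<Sum>k\<in>UNIV. \<Sum>l\<in>UNIV. \<Phi> i j k l * B $ i $ j * B $ k $ l)"

definition bfs :: "('m::finite \<Rightarrow> 'm \<Rightarrow> 'm \<Rightarrow> 'm \<Rightarrow> real) \<Rightarrow> real^'m^'m \<Rightarrow> real^'m^'m \<Rightarrow> real" where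
  "bfs \<Phi> B B' = (\<Sum>i\<in>UNIV. \<Sum>j\<in>UNIV. \<Sum>k\<in>UNIV. \<Sum>l\<in>UNIV.
      \<Phi> i j k l * (B $ i $ j * B' $ k $ l + B' $ i $ j * B $ k $ l)) / 2"

text \<open>Klein quadric: the (nonzero) quadratic form on bivectors vanishing on all decomposable
  bivectors, i.e. on the Pluecker images of all lines.\<close>
definition klein_form :: "('m::finite \<Rightarrow> 'm \<Rightarrow> 'm \<Rightarrow> 'm \<Rightarrow> real) \<Rightarrow> bool" where
  "klein_form \<Omega> \<longleftrightarrow> (\<forall>P V. qf \<Omega> (wedge P V) = 0) \<and> (\<exists>B\<in>bivectors. qf \<Omega> B \<noteq> 0)"

text \<open>Segre symbol [(222)] of the pencil Phi - lambda Omega: the operator T = Omega^-1 Phi - lambda0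
  on the bivector space (for a single eigenvalue lambda0) satisfies T^2 = 0 and has rank 3,
  i.e. one eigenvalue with three Jordan blocks of size 2.\<close>
definition segre_222 :: "('m::finite \<Rightarrow> 'm \<Rightarrow> 'm \<Rightarrow> 'm \<Rightarrow> real) \<Rightarrow> bool" where
  "segre_222 \<Phi> \<longleftrightarrow>
     (\<exists>\<Omega> lam0 (T::real^'m^'m \<Rightarrow> real^'m^'m).
        klein_form \<Omega> \<and> linear T \<and> T ` bivectors \<subseteq> bivectors \<and>
        (\<forall>B\<in>bivectors. \<forall>B'\<in>bivectors. bfs \<Omega> (T B) B' = bfs \<Phi> B B' - lam0 * bfs \<Omega> B B') \<and>
        (\<forall>B\<in>bivectors. T (T B) = 0) \<and>
        dim (T ` bivectors) = 3)"

text \<open>The null lines form the quadratic line complex Phi = 0: at every point p of U the cone of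
  lines of the complex through p (lines through hom p with direction dirv v) is the null cone.\<close>
definition null_quadratic_complex_222 :: "(real^'n) set \<Rightarrow> (real^'n \<Rightarrow> real^'n^'n) \<Rightarrow> bool" where
  "null_quadratic_complex_222 U F \<longleftrightarrow>
     (\<exists>\<Phi>. segre_222 \<Phi> \<and>
        (\<forall>p\<in>U. \<exists>\<mu>. \<mu> \<noteq> 0 \<and>
           (\<forall>v. v \<bullet> (F p *v v) = \<mu> * qf \<Phi> (wedge (hom p) (dirv v)))))"

end

theory Submission
  imports Defs
begin

text \<open>All conditions reduce to the third one: up to a factor, the form \<open>f\<close> at \<open>p\<close> is the pullback
  of a fixed quadratic form \<open>S\<close> under the projection from \<open>P = (p, 1)\<close> onto a fixed hyperplane
  \<open>h\<close>. Linearizability is this statement with the hyperplane moved to infinity. With \<open>l = h \<bullet> P\<close>,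
  the Hessian of \<open>S(P, P) / l\<close> is \<open>2 / l\<close> times the pullback of \<open>S\<close>, which is the Lagrangian
  condition. For \<open>n = 3\<close> the pullback of \<open>S\<close> is the quadratic complex
  \<open>B \<mapsto> S(\<iota>\<^sub>h B, \<iota>\<^sub>h B)\<close>, whose operator \<open>T\<close> has square zero and rank three.
  Conversely, the range of an operator \<open>T\<close> of Segre type \<open>[(222)]\<close> is a maximal isotropic subspace
  for the Klein form, hence consists of the lines through a point or of the lines in a hyperplane
  \<open>h\<close>. Nondegeneracy of \<open>f\<close> excludes the former, and in the latter case the complex depends on
  \<open>\<iota>\<^sub>h B\<close> only.\<close>

section \<open>Symmetric matrices and quadratic forms\<close>

lemma sum_option:
  "(\<Sum>i\<in>UNIV. f i) = f None + (\<Sum>k\<in>UNIV. f (Some k))"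
  for f :: "'n::finite option \<Rightarrow> 'b::comm_monoid_add"
  by (simp add: UNIV_option_conv sum.reindex)

lemma dot_transpose_mult:
  fixes A :: "real^'a^'b"
  shows "x \<bullet> (transpose A *v y) = (A *v x) \<bullet> y"
  by (metis dot_lmul_matrix inner_commute transpose_matrix_vector)

lemma det_nz_iff_ker:
  fixes A :: "real^'m^'m"
  shows "det A \<noteq> 0 \<longleftrightarrow> (\<forall>x. A *v x = 0 \<longrightarrow> x = 0)"
  by (simp add: invertible_det_nz [symmetric] invertible_left_inverse matrix_left_invertible_ker)

lemma quadratic_polar:
  fixes A :: "real^'m^'m"
  assumes "transpose A = A"
  shows "(x + y) \<bullet> (A *v (x + y)) = x \<bullet> (A *v x) + 2 * (x \<bullet> (A *v y)) + y \<bullet> (A *v y)"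
proof -
  have "y \<bullet> (A *v x) = x \<bullet> (A *v y)"
    by (metis assms dot_transpose_mult inner_commute)
  then show ?thesis
    by (simp add: matrix_vector_right_distrib inner_add_left inner_add_right)
qed

lemma symmetric_matrix_eqI:
  fixes A B :: "real^'m^'m"
  assumes "transpose A = A" "transpose B = B" "\<And>v. v \<bullet> (A *v v) = v \<bullet> (B *v v)"
  shows "A = B"
proof -
  have "x \<bullet> (A *v y) = x \<bullet> (B *v y)" for x y
    using quadratic_polar[OF assms(1), of x y] quadratic_polar[OF assms(2), of x y] assms(3)
    by simp
  then have "A *v y = B *v y" for y
    by (metis vector_eq_ldot)
  then show ?thesis
    using matrix_eq by blast
qed

text \<open>Polarization needs symmetric matrices, while the quadric and the quadratic part of a
  density are given by arbitrary ones; the symmetric part has the same quadratic form.\<close>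

lemma symmetrization:
  fixes S :: "real^'m^'m"
  obtains S' where "transpose S' = S'" "\<And>v. v \<bullet> (S' *v v) = v \<bullet> (S *v v)"
proof
  let ?S = "(1/2) *\<^sub>R (S + transpose S)"
  show "transpose ?S = ?S"
    by (simp add: transpose_def vec_eq_iff)
  show "v \<bullet> (?S *v v) = v \<bullet> (S *v v)" for v
  proof -
    have "v \<bullet> (transpose S *v v) = v \<bullet> (S *v v)"
      by (metis dot_transpose_mult inner_commute)
    then show ?thesis
      by (simp only: matrix_vector_mult_add_rdistrib scaleR_matrix_vector_assoc [symmetric]
          inner_add_right inner_scaleR_right) simp
  qed
qed

section \<open>Homogeneous coordinates and projection from a point onto a hyperplane\<close>

lemma hom_line: "hom (p + t *\<^sub>R v) = hom p + t *\<^sub>R dirv v"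
  by (auto simp: hom_def dirv_def vec_eq_iff split: option.split)

lemma hom_None [simp]: "hom p $ None = 1" and hom_Some [simp]: "hom p $ Some k = p $ k"
  and dirv_None [simp]: "dirv v $ None = 0" and dirv_Some [simp]: "dirv v $ Some k = v $ k"
  by (simp_all add: hom_def dirv_def)

lemma linear_dirv: "linear dirv"
  by (rule linearI) (auto simp: dirv_def vec_eq_iff split: option.split)

lemma dirv_eq_0_iff [simp]: "dirv v = 0 \<longleftrightarrow> v = 0"
proof
  assume "dirv v = 0"
  then have "dirv v $ Some k = 0" for k by simp
  then show "v = 0" by (simp add: vec_eq_iff)
qed (simp add: linear_0 linear_dirv)

lemma dirv_0 [simp]: "dirv 0 = 0"
  by simp

lemma dirv_eqI: "X $ None = 0 \<Longrightarrow> X = dirv (\<chi> k. X $ Some k)"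
  by (auto simp: dirv_def vec_eq_iff split: option.split)

lemma linear_proj_hyp: "linear (proj_hyp h p)"
proof -
  interpret linear dirv by (rule linear_dirv)
  show ?thesis
    by (rule linearI)
      (simp_all add: proj_hyp_def add scale inner_add_right add_divide_distrib algebra_simps)
qed

text \<open>Modulo \<open>hom p\<close> every vector is a direction, and the projection fixes the
  hyperplane pointwise.\<close>

lemma proj_hyp_surj:
  assumes "h \<bullet> hom p \<noteq> 0" "h \<bullet> w = 0"
  obtains v where "w = proj_hyp h p v"
proof
  define v where "v = (\<chi> k. (w - w $ None *\<^sub>R hom p) $ Some k)"
  have v: "dirv v = w - w $ None *\<^sub>R hom p"
    unfolding v_def by (rule dirv_eqI [symmetric]) simp
  show "w = proj_hyp h p v"
    using assms by (simp add: proj_hyp_def v inner_diff_right)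
qed

lemma proj_hyp_eqI:
  assumes "h \<bullet> hom p \<noteq> 0" "h \<bullet> (dirv v - s *\<^sub>R hom p) = 0"
  shows "proj_hyp h p v = dirv v - s *\<^sub>R hom p"
  using assms by (simp add: proj_hyp_def inner_diff_right)

section \<open>Lagrangian densities Q/l\<close>

text \<open>Along a coordinate line the density \<open>Q / l\<close> restricts to a quotient of this
  shape; the second derivatives are also composed of such quotients.\<close>

lemma DERIV_quadratic_over_linear:
  fixes l :: real
  assumes "l \<noteq> 0"
  shows "((\<lambda>t. (a + t * b + t * t * c) / (l + t * m)) has_real_derivative (b / l - a * m / l^2)) (at 0)"
  using assms
  by (auto intro!: derivative_eq_intros simp: field_simps power2_eq_square)

lemma partial_quadratic_over_linear:
  fixes S :: "real^('n::finite option)^('n option)"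
  assumes S: "transpose S = S" and l: "h \<bullet> hom p \<noteq> 0"
  shows "partial i (\<lambda>p. (hom p \<bullet> (S *v hom p)) / (h \<bullet> hom p)) p =
    2 * (dirv (axis i 1) \<bullet> (S *v hom p)) / (h \<bullet> hom p)
      - (hom p \<bullet> (S *v hom p)) * (h \<bullet> dirv (axis i 1)) / (h \<bullet> hom p)^2"
proof -
  let ?E = "dirv (axis i 1)" and ?P = "hom p"
  have *: "(hom (p + t *\<^sub>R axis i 1) \<bullet> (S *v hom (p + t *\<^sub>R axis i 1))) / (h \<bullet> hom (p + t *\<^sub>R axis i 1)) =
    (?P \<bullet> (S *v ?P) + t * (2 * (?E \<bullet> (S *v ?P))) + t * t * (?E \<bullet> (S *v ?E)))
      / (h \<bullet> ?P + t * (h \<bullet> ?E))" for t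
  proof -
    have "?P \<bullet> (S *v ?E) = ?E \<bullet> (S *v ?P)"
      by (metis S dot_transpose_mult inner_commute)
    then show ?thesis
      unfolding hom_line quadratic_polar [OF S]
      by (simp add: inner_add_right matrix_vector_mult_scaleR algebra_simps)
  qed
  show ?thesis
    unfolding partial_def *
    by (rule DERIV_imp_deriv) (rule DERIV_quadratic_over_linear [OF l])
qed

text \<open>The four terms of the second derivative are exactly the expansion of the bilinear form S
  at the basis directions, each corrected by the multiple of \<open>hom p\<close> that puts it on
  the hyperplane.\<close>

lemma hessian_quadratic_over_linear:
  fixes S :: "real^('n::finite option)^('n option)"
  assumes S: "transpose S = S" and l: "h \<bullet> hom p \<noteq> 0"
  shows "hessian (\<lambda>p. (hom p \<bullet> (S *v hom p)) / (h \<bullet> hom p)) p $ i $ j =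
    2 / (h \<bullet> hom p) * (proj_hyp h p (axis i 1) \<bullet> (S *v proj_hyp h p (axis j 1)))"
proof -
  let ?g = "\<lambda>p. (hom p \<bullet> (S *v hom p)) / (h \<bullet> hom p)"
  let ?Ei = "dirv (axis i 1)" and ?Ej = "dirv (axis j 1)" and ?P = "hom p"
  define L where "L = h \<bullet> ?P"
  define mi where "mi = h \<bullet> ?Ei"
  define mj where "mj = h \<bullet> ?Ej"
  define a where "a = ?P \<bullet> (S *v ?P)"
  define bi where "bi = ?Ei \<bullet> (S *v ?P)"
  define bj where "bj = ?Ej \<bullet> (S *v ?P)"
  define cii where "cii = ?Ei \<bullet> (S *v ?Ei)"
  define cij where "cij = ?Ei \<bullet> (S *v ?Ej)"
  have sym: "x \<bullet> (S *v y) = y \<bullet> (S *v x)" for x y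
    by (metis S dot_transpose_mult inner_commute)
  have L: "L \<noteq> 0" using l L_def by simp
  \<comment> \<open>G is the first partial derivative in direction j along the line through p in
    direction i. The formula is valid where the denominator does not vanish, hence near
    \<open>t = 0\<close>.\<close>
  define G where "G = (\<lambda>t. 2 * (bj + t * cij) / (L + t * mi)
     - (a + t * (2 * bi) + t * t * cii) * mj / (L + t * mi)^2)"
  have "((\<lambda>t. L + t * mi) \<longlongrightarrow> L + 0 * mi) (nhds 0)"
    by (intro tendsto_intros filterlim_ident)
  then have ev: "\<forall>\<^sub>F t in nhds 0. L + t * mi \<noteq> 0"
    using L by (intro tendsto_imp_eventually_ne) auto
  have "\<forall>\<^sub>F t in nhds 0. partial j ?g (p + t *\<^sub>R axis i 1) = G t"
    using ev
  proof eventually_elim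
    case (elim t)
    have hl: "h \<bullet> hom (p + t *\<^sub>R axis i 1) = L + t * mi"
      by (simp add: hom_line L_def mi_def inner_add_right)
    have q: "hom (p + t *\<^sub>R axis i 1) \<bullet> (S *v hom (p + t *\<^sub>R axis i 1)) = a + t * (2 * bi) + t * t * cii"
      unfolding hom_line quadratic_polar [OF S]
      by (simp add: matrix_vector_mult_scaleR a_def bi_def cii_def sym [of ?P ?Ei])
    have b: "?Ej \<bullet> (S *v hom (p + t *\<^sub>R axis i 1)) = bj + t * cij"
      by (simp add: hom_line matrix_vector_right_distrib inner_add_right matrix_vector_mult_scaleR
          bj_def cij_def sym [of ?Ej ?Ei])
    show ?case
      using partial_quadratic_over_linear [OF S, of h "p + t *\<^sub>R axis i 1" j] elim
      by (simp add: hl q b G_def mj_def)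
  qed
  then have "hessian ?g p $ i $ j = deriv G 0"
    by (simp add: hessian_def) (subst partial_def, rule deriv_cong_ev, simp_all)
  also have "deriv G 0 = 2 * cij / L - 2 * bj * mi / L^2 - 2 * bi * mj / L^2 + 2 * a * mi * mj / L^3"
  proof -
    let ?D = "\<lambda>x y z t. (x + t * y + t * t * z) / (L + t * mi)"
    \<comment> \<open>Writing \<open>1 / l^2\<close> as a product of two quotients with denominator
      l reduces the derivative to the rule for \<open>?D\<close>.\<close>
    have G: "G = (\<lambda>t. 2 * ?D bj cij 0 t - mj * (?D a (2 * bi) cii t * ?D 1 0 0 t))"
      by (simp add: G_def fun_eq_iff power2_eq_square mult_ac)
    note D = DERIV_quadratic_over_linear [OF L]
    have "(G has_real_derivative 2 * (cij / L - bj * mi / L^2)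
        - mj * ((2 * bi / L - a * mi / L^2) * ?D 1 0 0 0 + (0 / L - 1 * mi / L^2) * ?D a (2 * bi) cii 0))
        (at 0)"
      unfolding G by (intro DERIV_diff DERIV_cmult DERIV_mult D)
    then show ?thesis
      by (rule DERIV_imp_deriv [THEN trans])
        (simp add: diff_divide_distrib power2_eq_square power3_eq_cube, argo)
  qed
  also have "\<dots> = 2 / L * ((?Ei - (mi / L) *\<^sub>R ?P) \<bullet> (S *v (?Ej - (mj / L) *\<^sub>R ?P)))"
  proof -
    have "(?Ei - (mi / L) *\<^sub>R ?P) \<bullet> (S *v (?Ej - (mj / L) *\<^sub>R ?P))
      = cij - mj / L * bi - mi / L * bj + mi / L * (mj / L) * a"
      by (simp add: matrix_vector_mult_diff_distrib inner_diff_left inner_diff_right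
          matrix_vector_mult_scaleR cij_def bi_def bj_def a_def sym [of ?P ?Ej] algebra_simps)
    then show ?thesis
      by (simp only:) (use L in \<open>simp add: field_simps power2_eq_square power3_eq_cube\<close>)
  qed
  finally show ?thesis
    by (simp add: proj_hyp_def L_def mi_def mj_def)
qed

text \<open>The entrywise formula extends to every v by bilinearity, since
  \<open>proj_hyp h p\<close> is linear.\<close>

lemma hessian_quadratic_over_linear_form:
  fixes S :: "real^('n::finite option)^('n option)" and h p
  defines "H \<equiv> hessian (\<lambda>p. (hom p \<bullet> (S *v hom p)) / (h \<bullet> hom p)) p"
  assumes S: "transpose S = S" and l: "h \<bullet> hom p \<noteq> 0"
  shows "transpose H = H"
    and "v \<bullet> (H *v v) = 2 / (h \<bullet> hom p) * (proj_hyp h p v \<bullet> (S *v proj_hyp h p v))"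
proof -
  let ?e = "\<lambda>i. proj_hyp h p (axis i 1)"
  have H: "H $ i $ j = 2 / (h \<bullet> hom p) * (?e i \<bullet> (S *v ?e j))" for i j
    unfolding H_def by (rule hessian_quadratic_over_linear [OF S l])
  show "transpose H = H"
    using S by (simp add: vec_eq_iff transpose_def H) (metis S dot_transpose_mult inner_commute)
  interpret linear "proj_hyp h p" by (rule linear_proj_hyp)
  have "proj_hyp h p v = proj_hyp h p (\<Sum>i\<in>UNIV. v $ i *\<^sub>R axis i 1)"
    using basis_expansion [of v] by (simp add: scalar_mult_eq_scaleR)
  then have e: "proj_hyp h p v = (\<Sum>i\<in>UNIV. v $ i *\<^sub>R ?e i)"
    by (simp add: sum scale)
  have "S *v proj_hyp h p v = (\<Sum>j\<in>UNIV. v $ j *\<^sub>R (S *v ?e j))"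
    by (simp add: e linear_sum [OF matrix_vector_mul_linear] matrix_vector_mult_scaleR)
  then have "proj_hyp h p v \<bullet> (S *v proj_hyp h p v) =
    (\<Sum>j\<in>UNIV. \<Sum>i\<in>UNIV. v $ i * (v $ j * (?e i \<bullet> (S *v ?e j))))"
    by (simp add: e inner_sum_left inner_sum_right sum_distrib_left mult.left_commute)
  also have "\<dots> = (\<Sum>i\<in>UNIV. \<Sum>j\<in>UNIV. v $ i * (v $ j * (?e i \<bullet> (S *v ?e j))))"
    by (rule sum.swap)
  finally have E: "proj_hyp h p v \<bullet> (S *v proj_hyp h p v) = \<dots>" .
  have "v \<bullet> (H *v v) = (\<Sum>i\<in>UNIV. \<Sum>j\<in>UNIV. v $ i * (H $ i $ j * v $ j))"
    by (simp add: inner_vec_def matrix_vector_mult_def sum_distrib_left)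
  also have "\<dots> = 2 / (h \<bullet> hom p) * (proj_hyp h p v \<bullet> (S *v proj_hyp h p v))"
    unfolding E H sum_distrib_left by (intro sum.cong refl) simp
  finally show "v \<bullet> (H *v v) = 2 / (h \<bullet> hom p) * (proj_hyp h p v \<bullet> (S *v proj_hyp h p v))" .
qed

section \<open>Homogenization of the density and the Lagrangian condition\<close>

lemma inner_hom: "h \<bullet> hom p = (\<chi> i. h $ Some i) \<bullet> p + h $ None"
  by (simp add: inner_vec_def sum_option)

lemma hom_quadratic:
  fixes S :: "real^('n::finite option)^('n option)"
  assumes "transpose S = S"
  shows "hom p \<bullet> (S *v hom p) =
    p \<bullet> ((\<chi> i j. S $ Some i $ Some j) *v p) + (\<chi> i. 2 * S $ Some i $ None) \<bullet> p + S $ None $ None"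
proof -
  define A where "A = (\<chi> i j. S $ Some i $ Some j)"
  define c where "c = (\<chi> i. S $ Some i $ None)"
  have c': "c $ k = S $ None $ Some k" for k
  proof -
    have "transpose S $ None $ Some k = c $ k"
      by (simp add: transpose_def c_def)
    then show ?thesis
      using assms by simp
  qed
  have "(S *v hom p) $ None = c \<bullet> p + S $ None $ None"
    by (simp add: c' inner_vec_def matrix_vector_mult_def sum_option)
  moreover have "(\<chi> k. (S *v hom p) $ Some k) = c + A *v p"
    by (simp add: vec_eq_iff A_def c_def matrix_vector_mult_def sum_option)
  ultimately have "(S *v hom p) \<bullet> hom p = (c + A *v p) \<bullet> p + (c \<bullet> p + S $ None $ None)"
    by (simp add: inner_hom)
  moreover have "(\<chi> i. 2 * S $ Some i $ None) = 2 *\<^sub>R c"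
    by (simp add: c_def vec_eq_iff)
  ultimately show ?thesis
    by (simp add: A_def inner_commute [of _ p] inner_commute [of _ "hom p"] inner_add_left
        inner_add_right)
qed

lemma lagrangian_QL_iff:
  "lagrangian_QL U F \<longleftrightarrow> (\<exists>h S. transpose S = S \<and> (\<forall>p\<in>U. h \<bullet> hom p \<noteq> 0) \<and>
     lagrangian U F (\<lambda>p. (hom p \<bullet> (S *v hom p)) / (h \<bullet> hom p)))" (is "_ = ?R")
proof
  assume "lagrangian_QL U F"
  then obtain Aq bq c0 d e where l: "\<forall>p\<in>U. d \<bullet> p + e \<noteq> 0"
    and L: "lagrangian U F (\<lambda>p. (p \<bullet> (Aq *v p) + bq \<bullet> p + c0) / (d \<bullet> p + e))"
    unfolding lagrangian_QL_def by blast
  obtain A where A: "transpose A = A" "\<And>p. p \<bullet> (A *v p) = p \<bullet> (Aq *v p)"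
    using symmetrization by blast
  have A': "A $ i $ j = A $ j $ i" for i j
    using A(1) by (metis transpose_def vec_lambda_beta)
  \<comment> \<open>Each linear coefficient is split evenly between the two symmetric entries
    \<open>(None, k)\<close> and \<open>(k, None)\<close>.\<close>
  define S :: "real^('a option)^('a option)" where "S = (\<chi> i j. case i of
      None \<Rightarrow> (case j of None \<Rightarrow> c0 | Some b \<Rightarrow> bq $ b / 2)
    | Some a \<Rightarrow> (case j of None \<Rightarrow> bq $ a / 2 | Some b \<Rightarrow> A $ a $ b))"
  define h :: "real^('a option)" where "h = (\<chi> i. case i of None \<Rightarrow> e | Some k \<Rightarrow> d $ k)"
  have S: "transpose S = S"
    by (auto simp: S_def transpose_def vec_eq_iff A' split: option.split)
  have "hom p \<bullet> (S *v hom p) = p \<bullet> (Aq *v p) + bq \<bullet> p + c0" for p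
    unfolding hom_quadratic [OF S] by (simp add: S_def A(2) [symmetric])
  moreover have "h \<bullet> hom p = d \<bullet> p + e" for p
    unfolding inner_hom by (simp add: h_def)
  ultimately show ?R
    using S l L by (intro exI [of _ h] exI [of _ S]) simp
next
  assume ?R
  then show "lagrangian_QL U F"
    unfolding lagrangian_QL_def by (metis (no_types, lifting) ext hom_quadratic inner_hom)
qed

text \<open>The Hessian of \<open>Q / l\<close> is \<open>2 / l\<close> times the pullback of S, so
  the two conditions differ only by a rescaling of the factor at each point.\<close>

lemma lagrangian_QL_iff_cones:
  fixes U :: "(real^'n) set" and F :: "real^'n \<Rightarrow> real^'n^'n"
  assumes ne: "U \<noteq> {}" and sym: "\<forall>p\<in>U. transpose (F p) = F p" and det: "\<forall>p\<in>U. det (F p) \<noteq> 0"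
  shows "lagrangian_QL U F \<longleftrightarrow> cones_through_quadric U F"
proof
  assume "lagrangian_QL U F"
  then obtain h S where S: "transpose S = S" and l: "\<forall>p\<in>U. h \<bullet> hom p \<noteq> 0"
    and L: "lagrangian U F (\<lambda>p. (hom p \<bullet> (S *v hom p)) / (h \<bullet> hom p))"
    unfolding lagrangian_QL_iff by blast
  have "h \<noteq> 0" using l ne by auto
  moreover have "\<exists>\<mu>. \<mu> \<noteq> 0 \<and> (\<forall>v. v \<bullet> (F p *v v) = \<mu> * (proj_hyp h p v \<bullet> (S *v proj_hyp h p v)))"
    if p: "p \<in> U" for p
  proof -
    obtain \<mu> where \<mu>: "F p = \<mu> *\<^sub>R hessian (\<lambda>p. (hom p \<bullet> (S *v hom p)) / (h \<bullet> hom p)) p"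
      using L p unfolding lagrangian_def by blast
    \<comment> \<open>A zero factor would make \<open>F p\<close> zero, which is degenerate.\<close>
    have "\<mu> \<noteq> 0"
      using det p \<mu> det_0 [where 'n='n and 'a=real] by (auto simp: mat_0)
    moreover have "v \<bullet> (F p *v v) = \<mu> * (2 / (h \<bullet> hom p)) * (proj_hyp h p v \<bullet> (S *v proj_hyp h p v))" for v
      using hessian_quadratic_over_linear_form(2) [OF S, of h p v] l p
      by (simp add: \<mu> scaleR_matrix_vector_assoc [symmetric])
    ultimately show ?thesis
      using l p by (intro exI [of _ "\<mu> * (2 / (h \<bullet> hom p))"]) auto
  qed
  ultimately show "cones_through_quadric U F"
    using l unfolding cones_through_quadric_def by blast
next
  assume "cones_through_quadric U F"
  then obtain h S0 where l: "\<forall>p\<in>U. h \<bullet> hom p \<noteq> 0"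
    and F0: "\<forall>p\<in>U. \<exists>\<mu>. \<mu> \<noteq> 0 \<and> (\<forall>v. v \<bullet> (F p *v v) = \<mu> * (proj_hyp h p v \<bullet> (S0 *v proj_hyp h p v)))"
    unfolding cones_through_quadric_def by blast
  obtain S where S: "transpose S = S" "\<And>v. v \<bullet> (S *v v) = v \<bullet> (S0 *v v)"
    using symmetrization by blast
  have "\<exists>\<nu>. F p = \<nu> *\<^sub>R hessian (\<lambda>p. (hom p \<bullet> (S *v hom p)) / (h \<bullet> hom p)) p" (is "\<exists>\<nu>. _ = _ *\<^sub>R ?H")
    if p: "p \<in> U" for p
  proof -
    obtain \<mu> where \<mu>: "\<And>v. v \<bullet> (F p *v v) = \<mu> * (proj_hyp h p v \<bullet> (S *v proj_hyp h p v))"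
      using F0 p S(2) by metis
    have l': "h \<bullet> hom p \<noteq> 0" using l p by blast
    have "F p = (\<mu> * (h \<bullet> hom p) / 2) *\<^sub>R ?H"
    proof (rule symmetric_matrix_eqI)
      show "transpose (F p) = F p" using sym p by blast
      show "transpose ((\<mu> * (h \<bullet> hom p) / 2) *\<^sub>R ?H) = (\<mu> * (h \<bullet> hom p) / 2) *\<^sub>R ?H"
        using hessian_quadratic_over_linear_form(1) [OF S(1) l'] by (simp add: transpose_scalar)
      show "v \<bullet> (F p *v v) = v \<bullet> ((\<mu> * (h \<bullet> hom p) / 2) *\<^sub>R ?H *v v)" for v
        using hessian_quadratic_over_linear_form(2) [OF S(1) l', of v] l'
        by (simp add: scaleR_matrix_vector_assoc [symmetric] \<mu>)
    qed
    then show ?thesis by blast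
  qed
  then show "lagrangian_QL U F"
    unfolding lagrangian_QL_iff lagrangian_def using S(1) l by blast
qed


section \<open>Linearizability\<close>

text \<open>Under the equivalence group the hyperplane coordinates \<open>(p, -1)\<close>, rather than \<open>(p, 1)\<close>,
  transform linearly; this reflection converts between the two.\<close>
definition flip :: "real^('n::finite option)^('n option)" where
  "flip = (\<chi> i j. if i = j then (if i = None then -1 else 1) else 0)"

lemma flip_mult_vec: "(flip *v x) $ i = (if i = None then - x $ i else x $ i)"
  by (simp add: flip_def matrix_vector_mult_def if_distrib [where f = "\<lambda>a. a * _"] cong: if_cong)

lemma matrix_mult_flip: "(M ** flip) $ i $ j = (if j = None then - M $ i $ j else M $ i $ j)"
  by (simp add: flip_def matrix_matrix_mult_def if_distrib [where f = "\<lambda>a. _ * a"] cong: if_cong)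

lemma flip_flip [simp]: "flip ** flip = mat 1"
  by (simp add: matrix_eq matrix_vector_mul_assoc [symmetric] vec_eq_iff flip_mult_vec)

lemma vec_option_eqI: "X $ None = Y $ None \<Longrightarrow> (\<And>k. X $ Some k = Y $ Some k) \<Longrightarrow> X = Y"
  by (metis not_None_eq vec_eq_iff)

text \<open>Modulo \<open>hom p\<close>, the matrix \<open>transpose (Cbp M p)\<close>, which varies
  with p, acts on directions as the constant matrix \<open>transpose (M ** flip)\<close>. This is
  how a constant coefficient matrix turns into a constant quadric.\<close>

lemma transpose_mult_dirv:
  fixes M :: "real^('n::finite option)^('n option)" and w :: "real^'n"
  shows "transpose (M ** flip) *v dirv w
    = dirv (transpose (Cbp M p) *v w) - (\<Sum>k\<in>UNIV. M $ Some k $ None * w $ k) *\<^sub>R hom p"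
    (is "?L = ?R")
proof -
  have "?L $ None = ?R $ None"
    by (simp add: matrix_vector_mult_def transpose_def sum_option matrix_mult_flip sum_negf)
  moreover have "?L $ Some j = ?R $ Some j" for j
  proof -
    have "?L $ Some j = (\<Sum>k\<in>UNIV. M $ Some k $ Some j * w $ k)"
      by (simp add: matrix_vector_mult_def transpose_def sum_option matrix_mult_flip)
    moreover have "?R $ Some j = (\<Sum>k\<in>UNIV. Cbp M p $ k $ j * w $ k)
        - (\<Sum>k\<in>UNIV. M $ Some k $ None * w $ k) * p $ j"
      by (simp add: matrix_vector_mult_def transpose_def)
    moreover have "\<dots> = (\<Sum>k\<in>UNIV. M $ Some k $ Some j * w $ k)"
      unfolding sum_distrib_right sum_subtractf [symmetric]
      by (intro sum.cong refl) (simp add: Cbp_def algebra_simps)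
    ultimately show ?thesis
      by simp
  qed
  ultimately show ?thesis
    by (rule vec_option_eqI)
qed

text \<open>The quadric S of the cones and the constant matrix A of the linear equation determine each
  other: A is the restriction of S to the hyperplane h, spanned by the rows of the matrix
  \<open>M ** flip\<close> other than the last one.\<close>
lemma cone_pullback:
  fixes M S :: "real^('n::finite option)^('n option)" and F A :: "real^'n^'n"
  defines "N \<equiv> M ** flip"
  assumes N: "invertible N" and h: "\<And>w. h \<bullet> (transpose N *v dirv w) = 0" and h0: "h \<noteq> 0"
    and A: "\<And>w. w \<bullet> (A *v w) = (transpose N *v dirv w) \<bullet> (S *v (transpose N *v dirv w))"
  shows "h \<bullet> hom p \<noteq> 0 \<longleftrightarrow> det (Cbp M p) \<noteq> 0"
    and "h \<bullet> hom p \<noteq> 0 \<Longrightarrow>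
      (\<forall>v. v \<bullet> (F *v v) = \<mu> * (proj_hyp h p v \<bullet> (S *v proj_hyp h p v))) \<longleftrightarrow>
      (\<forall>w. w \<bullet> ((Cbp M p ** F ** transpose (Cbp M p)) *v w) = \<mu> * (w \<bullet> (A *v w)))"
proof -
  let ?G = "Cbp M p" and ?s = "\<lambda>w. \<Sum>k\<in>UNIV. M $ Some k $ None * w $ k"
  have Nt: "transpose N *v dirv w = dirv (transpose ?G *v w) - ?s w *\<^sub>R hom p" for w
    unfolding N_def by (rule transpose_mult_dirv)
  have invNt: "invertible (transpose N)"
    using N by (simp add: invertible_det_nz det_transpose)
  then have inj: "x = y" if "transpose N *v x = transpose N *v y" for x y
    using that by (metis inj_matrix_vector_mult injD)
  show det: "h \<bullet> hom p \<noteq> 0 \<longleftrightarrow> det ?G \<noteq> 0"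
  proof
    assume l: "h \<bullet> hom p \<noteq> 0"
    \<comment> \<open>For such w the vector \<open>transpose N *v dirv w\<close> is a multiple of
      \<open>hom p\<close> lying on the hyperplane, hence zero.\<close>
    have "w = 0" if "transpose ?G *v w = 0" for w
    proof -
      have "h \<bullet> (dirv (transpose ?G *v w) - ?s w *\<^sub>R hom p) = 0"
        using h [of w] Nt by simp
      then have "transpose N *v dirv w = 0"
        using l that Nt [of w] by (simp add: inner_diff_right)
      then have "dirv w = 0"
        using inj [of "dirv w" 0] by simp
      then show ?thesis by simp
    qed
    then have "det (transpose ?G) \<noteq> 0"
      unfolding det_nz_iff_ker by blast
    then show "det ?G \<noteq> 0"
      by simp
  next
    assume G: "det ?G \<noteq> 0"
    show "h \<bullet> hom p \<noteq> 0"
    proof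
      \<comment> \<open>If \<open>hom p\<close> lies on the hyperplane, it is
        \<open>transpose N *v dirv w\<close> for some w. Its \<open>None\<close> coordinate forces
        \<open>?s w = - 1\<close>, so \<open>transpose ?G\<close> kills w.\<close>
      assume hp: "h \<bullet> hom p = 0"
      have "surj ((*v) (transpose N))"
        using invNt invertible_eq_bij bij_is_surj by blast
      then obtain y where y: "hom p = transpose N *v y"
        by (metis surjD)
      \<comment> \<open>\<open>N *v h\<close> is orthogonal to all directions, so only its
        \<open>None\<close> entry survives; orthogonality to y then makes y a direction.\<close>
      have Nh: "(N *v h) $ Some k = 0" for k
      proof -
        have "dirv (axis k 1) = axis (Some k) (1::real)"
          by (auto simp: vec_eq_iff dirv_def axis_def split: option.split)
        then show ?thesis
          using h [of "axis k 1"] unfolding dot_transpose_mult by (simp add: inner_axis)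
      qed
      have "N *v h \<noteq> 0"
        using N h0 by (metis det_nz_iff_ker invertible_det_nz)
      then have "(N *v h) $ None \<noteq> 0"
        using Nh vec_option_eqI [of "N *v h" 0] by auto
      moreover have "(N *v h) $ None * y $ None = 0"
      proof -
        have "(N *v h) \<bullet> y = 0"
          using hp unfolding y dot_transpose_mult .
        then show ?thesis
          by (simp add: inner_vec_def sum_option Nh)
      qed
      ultimately have "y $ None = 0"
        by simp
      then obtain w where w: "y = dirv w"
        using dirv_eqI by blast
      have e: "hom p + ?s w *\<^sub>R hom p = dirv (transpose ?G *v w)"
        using y w Nt [of w] by (simp add: algebra_simps)
      have "1 + ?s w = 0"
        using arg_cong [OF e, of "\<lambda>x. x $ None"] by simp
      then have "?s w = - 1"
        by linarith
      then have "dirv (transpose ?G *v w) = 0"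
        unfolding e [symmetric] by simp
      then have "transpose ?G *v w = 0"
        by (simp only: dirv_eq_0_iff)
      then have "w = 0"
        using G by (metis det_transpose det_nz_iff_ker)
      then have "hom p = 0"
        using y w by simp
      then show False
        using hom_None [of p] by simp
    qed
  qed
  assume l: "h \<bullet> hom p \<noteq> 0"
  \<comment> \<open>\<open>transpose N *v dirv w\<close> lies on the hyperplane and differs from
    \<open>dirv (transpose ?G *v w)\<close> by a multiple of \<open>hom p\<close>, which
    characterizes the projection.\<close>
  have proj: "proj_hyp h p (transpose ?G *v w) = transpose N *v dirv w" for w
    using proj_hyp_eqI [OF l] h [of w] Nt [of w] by simp
  have "invertible (transpose ?G)"
    using l det by (simp add: invertible_det_nz)
  then have surj: "\<exists>w. v = transpose ?G *v w" for v
    by (metis invertible_eq_bij bij_is_surj surjD)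
  have FG: "w \<bullet> ((?G ** F ** transpose ?G) *v w) = (transpose ?G *v w) \<bullet> (F *v (transpose ?G *v w))" for w
    by (simp only: dot_transpose_mult [of w "transpose ?G", symmetric] matrix_vector_mul_assoc
        transpose_transpose matrix_mul_assoc)
  show "(\<forall>v. v \<bullet> (F *v v) = \<mu> * (proj_hyp h p v \<bullet> (S *v proj_hyp h p v))) \<longleftrightarrow>
      (\<forall>w. w \<bullet> ((Cbp M p ** F ** transpose (Cbp M p)) *v w) = \<mu> * (w \<bullet> (A *v w)))"
    unfolding FG A proj [symmetric] using surj by metis
qed

lemma det_flip_square:
  "det (flip :: real^('n::finite option)^('n option)) * det (flip :: real^('n option)^('n option)) = 1"
  using det_mul [of "flip :: real^('n option)^('n option)" flip] by simp

lemma inner_dirv_block: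
  "dirv w \<bullet> (B *v dirv w) = w \<bullet> ((\<chi> i j. B $ Some i $ Some j) *v w)"
  by (simp add: inner_vec_def matrix_vector_mult_def sum_option)

text \<open>From M and A, the hyperplane is the image of the directions under
  \<open>transpose N\<close>, and A is transported to it. From h and S, a rotation sends h to the
  \<open>None\<close> axis, and A is the restriction of S in the rotated coordinates.\<close>

lemma linearizable_iff_cones:
  fixes U :: "(real^'n) set" and F :: "real^'n \<Rightarrow> real^'n^'n"
  assumes sym: "\<forall>p\<in>U. transpose (F p) = F p" and det: "\<forall>p\<in>U. det (F p) \<noteq> 0"
  shows "linearizable U F \<longleftrightarrow> cones_through_quadric U F"
proof
  assume "linearizable U F"
  then obtain M A where M: "det M = 1" and G: "\<forall>p\<in>U. det (Cbp M p) \<noteq> 0"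
    and FA: "\<forall>p\<in>U. \<exists>\<mu>. Cbp M p ** F p ** transpose (Cbp M p) = \<mu> *\<^sub>R A"
    unfolding linearizable_def by blast
  define N where "N = M ** flip"
  have N: "invertible N"
    using M det_flip_square [where 'n='n] by (auto simp: N_def invertible_det_nz det_mul)
  obtain R where NR: "N ** R = mat 1"
    using N unfolding invertible_def by blast
  \<comment> \<open>B extends A by zero; any extension restricts to A on directions, and R, the
    inverse of N, carries it back to the original coordinates.\<close>
  define B :: "real^('n option)^('n option)"
    where "B = (\<chi> i j. case (i, j) of (Some a, Some b) \<Rightarrow> A $ a $ b | _ \<Rightarrow> 0)"
  define h where "h = R *v axis None 1"
  define S where "S = R ** B ** transpose R"
  have Nh: "N *v h = axis None 1"
    by (simp add: h_def matrix_vector_mul_assoc NR)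
  have h: "h \<bullet> (transpose N *v dirv w) = 0" for w
    unfolding dot_transpose_mult Nh by (simp add: inner_axis')
  have h0: "h \<noteq> 0"
    using Nh by (auto simp: axis_eq_0_iff)
  have A: "w \<bullet> (A *v w) = (transpose N *v dirv w) \<bullet> (S *v (transpose N *v dirv w))" for w
  proof -
    have "transpose R *v (transpose N *v dirv w) = dirv w"
      by (metis NR matrix_transpose_mul matrix_vector_mul_assoc matrix_vector_mul_lid transpose_mat)
    moreover have "S *v x = R *v (B *v (transpose R *v x))" for x
      by (simp only: S_def matrix_vector_mul_assoc matrix_mul_assoc)
    ultimately have "(transpose N *v dirv w) \<bullet> (S *v (transpose N *v dirv w)) = dirv w \<bullet> (B *v dirv w)"
      by (metis dot_transpose_mult transpose_transpose)
    then show ?thesis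
      unfolding inner_dirv_block by (simp add: B_def)
  qed
  note pullback = cone_pullback [of M h A S, folded N_def, OF N h h0 A]
  have "h \<bullet> hom p \<noteq> 0 \<and>
      (\<exists>\<mu>. \<mu> \<noteq> 0 \<and> (\<forall>v. v \<bullet> (F p *v v) = \<mu> * (proj_hyp h p v \<bullet> (S *v proj_hyp h p v))))"
    if p: "p \<in> U" for p
  proof -
    have l: "h \<bullet> hom p \<noteq> 0"
      using pullback(1) G p by blast
    obtain \<mu> where \<mu>: "Cbp M p ** F p ** transpose (Cbp M p) = \<mu> *\<^sub>R A"
      using FA p by blast
    have "det (\<mu> *\<^sub>R A) \<noteq> 0"
      unfolding \<mu> [symmetric] using G det p by (simp add: det_mul)
    then have "\<mu> \<noteq> 0"
      using det_0 [where 'n='n and 'a=real] by (auto simp: mat_0)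
    moreover have "\<forall>v. v \<bullet> (F p *v v) = \<mu> * (proj_hyp h p v \<bullet> (S *v proj_hyp h p v))"
      unfolding pullback(2) [OF l] \<mu> by (simp add: scaleR_matrix_vector_assoc [symmetric])
    ultimately show ?thesis
      using l by blast
  qed
  then show "cones_through_quadric U F"
    unfolding cones_through_quadric_def using h0 by blast
next
  assume "cones_through_quadric U F"
  then obtain h S where h0: "h \<noteq> 0" and l: "\<forall>p\<in>U. h \<bullet> hom p \<noteq> 0"
    and FS: "\<forall>p\<in>U. \<exists>\<mu>. \<mu> \<noteq> 0 \<and> (\<forall>v. v \<bullet> (F p *v v) = \<mu> * (proj_hyp h p v \<bullet> (S *v proj_hyp h p v)))"
    unfolding cones_through_quadric_def by blast
  have "2 \<le> CARD('n option)"
    by (simp add: card_option Suc_leI)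
  then obtain f where f: "orthogonal_transformation f" "det (matrix f) = 1"
      "f h = norm h *\<^sub>R axis None 1"
    by (rule rotation_exists [of h "norm h *\<^sub>R axis None 1"]) (simp_all add: norm_axis_1)
  define R where "R = matrix f"
  have R: "R *v h = norm h *\<^sub>R axis None 1"
    using f by (simp add: R_def matrix_works orthogonal_transformation_linear)
  \<comment> \<open>With this conjugation \<open>N = flip ** R\<close>, whose rows other than
    \<open>None\<close> are rows of the rotation R orthogonal to h, while the two flips cancel in
    the determinant.\<close>
  define M where "M = flip ** R ** flip"
  define N where "N = M ** flip"
  have NR: "N = flip ** R"
    by (simp add: N_def M_def matrix_mul_assoc [symmetric])
  note flip2 = det_flip_square [where 'n='n]
  have M: "det M = 1"
    using f(2) flip2 by (simp add: M_def R_def det_mul)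
  have N: "invertible N"
    using f(2) flip2 by (auto simp: NR R_def invertible_det_nz det_mul)
  have h: "h \<bullet> (transpose N *v dirv w) = 0" for w
  proof -
    have "h \<bullet> (transpose N *v dirv w) = (flip *v (R *v h)) \<bullet> dirv w"
      by (simp only: dot_transpose_mult NR matrix_vector_mul_assoc)
    also have "\<dots> = 0"
      unfolding R inner_vec_def sum_option by (simp add: flip_mult_vec axis_def)
    finally show ?thesis .
  qed
  obtain A where At: "transpose A = A"
    and A': "\<And>w. w \<bullet> (A *v w) = w \<bullet> ((\<chi> i j. (N ** S ** transpose N) $ Some i $ Some j) *v w)"
    using symmetrization by blast
  have A: "w \<bullet> (A *v w) = (transpose N *v dirv w) \<bullet> (S *v (transpose N *v dirv w))" for w
  proof -
    have "(N ** S ** transpose N) *v dirv w = N *v (S *v (transpose N *v dirv w))"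
      by (simp only: matrix_vector_mul_assoc matrix_mul_assoc)
    then show ?thesis
      unfolding A' inner_dirv_block [symmetric] by (metis dot_transpose_mult transpose_transpose)
  qed
  note pullback = cone_pullback [of M h A S, folded N_def, OF N h h0 A]
  have "det (Cbp M p) \<noteq> 0 \<and> (\<exists>\<mu>. Cbp M p ** F p ** transpose (Cbp M p) = \<mu> *\<^sub>R A)"
    if p: "p \<in> U" for p
  proof -
    have lp: "h \<bullet> hom p \<noteq> 0" using l p by blast
    obtain \<mu> where "\<forall>v. v \<bullet> (F p *v v) = \<mu> * (proj_hyp h p v \<bullet> (S *v proj_hyp h p v))"
      using FS p by blast
    then have \<mu>: "w \<bullet> ((Cbp M p ** F p ** transpose (Cbp M p)) *v w) = \<mu> * (w \<bullet> (A *v w))" for w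
      unfolding pullback(2) [OF lp] by blast
    have "Cbp M p ** F p ** transpose (Cbp M p) = \<mu> *\<^sub>R A"
    proof (rule symmetric_matrix_eqI)
      show "transpose (Cbp M p ** F p ** transpose (Cbp M p)) = Cbp M p ** F p ** transpose (Cbp M p)"
        using sym p by (simp add: matrix_transpose_mul matrix_mul_assoc)
    qed (simp_all add: At transpose_scalar \<mu> scaleR_matrix_vector_assoc [symmetric])
    then show ?thesis
      using pullback(1) lp by blast
  qed
  then show "linearizable U F"
    unfolding linearizable_def using M by blast
qed

section \<open>Quadratic forms on bivectors\<close>

lemma bivector_entry:
  assumes "B \<in> bivectors"
  shows "B $ j $ i = - B $ i $ j"
proof -
  have "transpose B $ i $ j = - B $ i $ j"
    using assms by (simp add: bivectors_def)
  then show ?thesis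
    by (simp add: transpose_def)
qed

lemma bivectorI:
  assumes "\<And>i j. B $ j $ i = - B $ i $ j"
  shows "B \<in> bivectors"
proof -
  have "transpose B $ i $ j = (- B) $ i $ j" for i j
    by (simp add: transpose_def) (rule assms)
  then show ?thesis
    by (simp add: bivectors_def vec_eq_iff)
qed

lemma bivector_diag: "B \<in> bivectors \<Longrightarrow> B $ i $ i = 0" for B :: "real^'m^'m"
  using bivector_entry [of B i i] by simp

lemma subspace_bivectors: "subspace (bivectors :: (real^'m^'m) set)"
proof (rule subspaceI)
  fix x y :: "real^'m^'m" and c :: real
  assume x: "x \<in> bivectors"
  show "c *\<^sub>R x \<in> bivectors"
    by (rule bivectorI, unfold vector_scaleR_component, subst bivector_entry [OF x]) simp
  assume y: "y \<in> bivectors"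
  show "x + y \<in> bivectors"
    by (rule bivectorI, unfold vector_add_component, subst bivector_entry [OF x],
        subst bivector_entry [OF y]) simp
qed (simp add: bivectorI)

lemma wedge_bivector: "wedge P V \<in> bivectors"
  by (rule bivectorI) (simp add: wedge_def)

lemma linear_wedge: "linear (wedge P)"
  by (rule linearI) (simp_all add: wedge_def vec_eq_iff algebra_simps)

lemma wedge_add_left: "wedge (P + P') V = wedge P V + wedge P' V"
  by (simp add: wedge_def vec_eq_iff algebra_simps)

lemma wedge_swap: "wedge V P = - wedge P V"
  by (simp add: wedge_def vec_eq_iff)

lemma wedge_0 [simp]: "wedge P 0 = 0"
  by (simp add: wedge_def vec_eq_iff)

text \<open>\<open>h v* B\<close> is the interior product of h with B. For a line not contained in
  the hyperplane h it represents the point where the line meets that hyperplane.\<close>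

lemma vector_mult_wedge: "h v* wedge P V = (h \<bullet> P) *\<^sub>R V - (h \<bullet> V) *\<^sub>R P"
  by (simp add: vec_eq_iff vector_matrix_mult_def wedge_def inner_vec_def right_diff_distrib
      sum_subtractf sum_distrib_left mult_ac)

lemma vector_mult_bivector:
  assumes "B \<in> bivectors"
  shows "h v* B = - (B *v h)"
proof -
  have "transpose B = - B"
    using assms by (simp add: bivectors_def)
  then have "h v* B = (- B) *v h"
    unfolding transpose_matrix_vector [symmetric] by (rule arg_cong)
  then show ?thesis
    by (simp add: vec_eq_iff matrix_vector_mult_def sum_negf)
qed

lemma bivector_inner_self: "B \<in> bivectors \<Longrightarrow> x \<bullet> (B *v x) = 0"
  using vector_mult_bivector [of B x] dot_lmul_matrix [of x B x]
  by (simp add: inner_commute)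

lemma vector_mult_bivector_orthogonal: "B \<in> bivectors \<Longrightarrow> h \<bullet> (h v* B) = 0"
  by (simp add: vector_mult_bivector bivector_inner_self)

section \<open>Polarized quadratic forms on bivectors and contraction with a covector\<close>

definition bil :: "('m::finite \<Rightarrow> 'm \<Rightarrow> 'm \<Rightarrow> 'm \<Rightarrow> real) \<Rightarrow> real^'m^'m \<Rightarrow> real^'m^'m \<Rightarrow> real" where
  "bil \<Phi> B B' = (\<Sum>i\<in>UNIV. \<Sum>j\<in>UNIV. \<Sum>k\<in>UNIV. \<Sum>l\<in>UNIV. \<Phi> i j k l * B $ i $ j * B' $ k $ l)"

lemma bfs_bil: "bfs \<Phi> B B' = (bil \<Phi> B B' + bil \<Phi> B' B) / 2"
  by (simp add: bfs_def bil_def sum.distrib distrib_left mult.assoc)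

lemma qf_bil: "qf \<Phi> B = bil \<Phi> B B"
  by (simp add: qf_def bil_def)

lemma bfs_self: "bfs \<Phi> B B = qf \<Phi> B"
  by (simp add: bfs_bil qf_bil)

lemma bfs_sym: "bfs \<Phi> B B' = bfs \<Phi> B' B"
  by (simp add: bfs_bil)

lemma linear_bfs: "linear (bfs \<Phi> B)"
proof -
  have "linear (bil \<Phi> B)" "linear (\<lambda>B'. bil \<Phi> B' B)"
    by (rule linearI; simp add: bil_def sum.distrib distrib_left distrib_right sum_distrib_left
        mult.assoc mult.left_commute)+
  then show ?thesis
    unfolding bfs_bil [abs_def] divide_real_def
    by (intro linearI)
      (simp_all add: linear_add [of "bil \<Phi> B"] linear_scale [of "bil \<Phi> B"]
        linear_add [of "\<lambda>B'. bil \<Phi> B' B"] linear_scale [of "\<lambda>B'. bil \<Phi> B' B"] algebra_simps)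
qed

lemmas bfs_linear =
  linear_add [OF linear_bfs] linear_scale [OF linear_bfs] linear_0 [OF linear_bfs]
  linear_neg [OF linear_bfs] linear_diff [OF linear_bfs]
  
lemma bfs_linear_left:
  "bfs \<Phi> (B + B') C = bfs \<Phi> B C + bfs \<Phi> B' C" "bfs \<Phi> (r *\<^sub>R B) C = r * bfs \<Phi> B C"
  "bfs \<Phi> (- B) C = - bfs \<Phi> B C" "bfs \<Phi> (B - B') C = bfs \<Phi> B C - bfs \<Phi> B' C"
  by (simp_all add: bfs_sym [of _ _ C] bfs_linear)

lemma qf_add: "qf \<Phi> (B + B') = qf \<Phi> B + 2 * bfs \<Phi> B B' + qf \<Phi> B'"
  by (simp add: bfs_self [symmetric] bfs_linear bfs_linear_left bfs_sym [of _ B' B])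

lemma bilinear_form_matrix:
  fixes f :: "real^'m \<Rightarrow> real^'m \<Rightarrow> real"
  assumes "\<And>x. linear (f x)" "\<And>y. linear (\<lambda>x. f x y)"
  obtains S where "\<And>x y. f x y = x \<bullet> (S *v y)"
proof
  fix x y :: "real^'m"
  have e: "z = (\<Sum>i\<in>UNIV. z $ i *\<^sub>R axis i 1)" for z :: "real^'m"
    using basis_expansion [of z] by (simp add: scalar_mult_eq_scaleR)
  have "f x y = (\<Sum>i\<in>UNIV. x $ i * f (axis i 1) y)"
    by (subst e [of x]) (simp add: linear_sum [OF assms(2)] linear_scale [OF assms(2)])
  also have "\<dots> = (\<Sum>i\<in>UNIV. x $ i * (\<Sum>j\<in>UNIV. f (axis i 1) (axis j 1) * y $ j))"
    by (subst e [of y]) (simp add: linear_sum [OF assms(1)] linear_scale [OF assms(1)] mult_ac)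
  also have "\<dots> = x \<bullet> ((\<chi> i j. f (axis i 1) (axis j 1)) *v y)"
    by (simp add: inner_vec_def matrix_vector_mult_def)
  finally show "f x y = x \<bullet> ((\<chi> i j. f (axis i 1) (axis j 1)) *v y)" .
qed

text \<open>The array h(i) h(k) S(j,l) encodes the complex that applies S to the contraction of B
  with h.\<close>

lemma bfs_contraction:
  fixes S :: "real^'m^'m"
  assumes S: "transpose S = S"
  shows "bfs (\<lambda>i j k l. h $ i * h $ k * S $ j $ l) B B' = (h v* B) \<bullet> (S *v (h v* B'))"
proof -
  have b: "bil (\<lambda>i j k l. h $ i * h $ k * S $ j $ l) B B' = (h v* B) \<bullet> (S *v (h v* B'))" for B B'
  proof -
    have "(\<Sum>i\<in>UNIV. \<Sum>k\<in>UNIV. \<Sum>l\<in>UNIV. h $ i * h $ k * S $ j $ l * B $ i $ j * B' $ k $ l) =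
      (h v* B) $ j * (S *v (h v* B')) $ j" for j
    proof -
      have "(S *v (h v* B')) $ j = (\<Sum>k\<in>UNIV. \<Sum>l\<in>UNIV. S $ j $ l * (B' $ k $ l * h $ k))"
        by (subst sum.swap) (simp add: matrix_vector_mult_def vector_matrix_mult_def sum_distrib_left mult_ac)
      then show ?thesis
        by (simp only: vector_matrix_mult_def vec_lambda_beta sum_distrib_right)
          (simp add: sum_distrib_left mult_ac)
    qed
    then show ?thesis
      unfolding bil_def inner_vec_def by (subst sum.swap) simp
  qed
  have "(h v* B') \<bullet> (S *v (h v* B)) = (h v* B) \<bullet> (S *v (h v* B'))"
    by (metis S dot_transpose_mult inner_commute)
  then show ?thesis
    by (simp add: bfs_bil b)
qed

text \<open>The contraction of a line through \<open>hom p\<close> is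
  \<open>h \<bullet> hom p\<close> times the projected direction, so the lines of this complex
  through p form the cone over the quadric S.\<close>

lemma qf_contraction_wedge:
  assumes "transpose S = S" "h \<bullet> hom p \<noteq> 0"
  shows "qf (\<lambda>i j k l. h $ i * h $ k * S $ j $ l) (wedge (hom p) (dirv v))
    = (h \<bullet> hom p)^2 * (proj_hyp h p v \<bullet> (S *v proj_hyp h p v))"
proof -
  have "h v* wedge (hom p) (dirv v) = (h \<bullet> hom p) *\<^sub>R proj_hyp h p v"
    using assms(2) by (simp add: vector_mult_wedge proj_hyp_def scaleR_diff_right)
  then show ?thesis
    by (simp add: bfs_self [symmetric] bfs_contraction assms(1) matrix_vector_mult_scaleR
        power2_eq_square)
qed

section \<open>Bivectors on a four-dimensional space: Klein form and duality\<close>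

locale four_indices =
  fixes i0 i1 i2 i3 :: "'m::finite"
  assumes distinct: "distinct [i0, i1, i2, i3]" and univ: "UNIV = {i0, i1, i2, i3}"
begin

lemma neqs: "i0 \<noteq> i1" "i0 \<noteq> i2" "i0 \<noteq> i3" "i1 \<noteq> i2" "i1 \<noteq> i3" "i2 \<noteq> i3"
  "i1 \<noteq> i0" "i2 \<noteq> i0" "i3 \<noteq> i0" "i2 \<noteq> i1" "i3 \<noteq> i1" "i3 \<noteq> i2"
  using distinct by auto

lemma sum4: "(\<Sum>i\<in>UNIV. f i) = f i0 + f i1 + f i2 + f i3" for f :: "'m \<Rightarrow> 'b::comm_monoid_add"
  unfolding univ by (simp add: neqs add.assoc)

lemma all4: "(\<forall>i. P i) \<longleftrightarrow> P i0 \<and> P i1 \<and> P i2 \<and> P i3"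
proof -
  have "(\<forall>i. P i) \<longleftrightarrow> (\<forall>i\<in>UNIV. P i)" by simp
  then show ?thesis unfolding univ by simp
qed

lemma card4: "CARD('m) = 4"
  unfolding univ by (simp add: neqs)

lemma bivector_entries:
  assumes "B \<in> bivectors"
  shows "B $ i0 $ i0 = 0" "B $ i1 $ i1 = 0" "B $ i2 $ i2 = 0" "B $ i3 $ i3 = 0"
    "B $ i1 $ i0 = - B $ i0 $ i1" "B $ i2 $ i0 = - B $ i0 $ i2" "B $ i3 $ i0 = - B $ i0 $ i3"
    "B $ i2 $ i1 = - B $ i1 $ i2" "B $ i3 $ i1 = - B $ i1 $ i3" "B $ i3 $ i2 = - B $ i2 $ i3"
  by (fact bivector_diag [OF assms] bivector_entry [OF assms])+

lemma bivector_eqI: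
  assumes "B \<in> bivectors" "C \<in> bivectors"
    "B $ i0 $ i1 = C $ i0 $ i1" "B $ i0 $ i2 = C $ i0 $ i2" "B $ i0 $ i3 = C $ i0 $ i3"
    "B $ i1 $ i2 = C $ i1 $ i2" "B $ i1 $ i3 = C $ i1 $ i3" "B $ i2 $ i3 = C $ i2 $ i3"
  shows "B = C"
  unfolding vec_eq_iff all4
  by (simp add: bivector_entries [OF assms(1)] bivector_entries [OF assms(2)] assms(3-))

text \<open>The polarized Pfaffian, that is, the Klein form in Pluecker coordinates; on bivectors
  \<open>pf B B\<close> is twice the Pfaffian of B.\<close>

definition pf :: "real^'m^'m \<Rightarrow> real^'m^'m \<Rightarrow> real" where
  "pf B C = B $ i0 $ i1 * C $ i2 $ i3 + B $ i2 $ i3 * C $ i0 $ i1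
    - B $ i0 $ i2 * C $ i1 $ i3 - B $ i1 $ i3 * C $ i0 $ i2
    + B $ i0 $ i3 * C $ i1 $ i2 + B $ i1 $ i2 * C $ i0 $ i3"

abbreviation E :: "'m \<Rightarrow> 'm \<Rightarrow> real^'m^'m" where
  "E i j \<equiv> wedge (axis i 1) (axis j 1)"

text \<open>The Hodge star of the standard basis: it exchanges complementary Pluecker coordinates up
  to sign.\<close>

definition star :: "real^'m^'m \<Rightarrow> real^'m^'m" where
  "star K = K $ i2 $ i3 *\<^sub>R E i0 i1 - K $ i1 $ i3 *\<^sub>R E i0 i2 + K $ i1 $ i2 *\<^sub>R E i0 i3
    + K $ i0 $ i3 *\<^sub>R E i1 i2 - K $ i0 $ i2 *\<^sub>R E i1 i3 + K $ i0 $ i1 *\<^sub>R E i2 i3"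

lemma star_bivector: "star K \<in> bivectors"
  by (rule bivectorI) (simp add: star_def wedge_def algebra_simps)

lemma star_entries:
  "star K $ i0 $ i1 = K $ i2 $ i3" "star K $ i0 $ i2 = - K $ i1 $ i3" "star K $ i0 $ i3 = K $ i1 $ i2"
  "star K $ i1 $ i2 = K $ i0 $ i3" "star K $ i1 $ i3 = - K $ i0 $ i2" "star K $ i2 $ i3 = K $ i0 $ i1"
  by (simp_all add: star_def wedge_def axis_def neqs)

lemma linear_star: "linear star"
  by (rule linearI)
    (simp_all add: star_def scaleR_add_left scaleR_add_right scaleR_diff_right algebra_simps)

lemma star_star: "K \<in> bivectors \<Longrightarrow> star (star K) = K"
  by (rule bivector_eqI) (simp_all add: star_bivector star_entries)

lemma pf_0 [simp]: "pf 0 B = 0"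
  by (simp add: pf_def)

lemma pf_wedge: "pf (wedge P V) (wedge P V) = 0"
  by (simp add: pf_def wedge_def algebra_simps)

text \<open>Pairing with a basis bivector reads off the complementary coordinate up to sign.\<close>

lemma pf_nondegenerate:
  assumes "K \<in> bivectors" "\<And>B. B \<in> bivectors \<Longrightarrow> pf K B = 0"
  shows "K = 0"
proof -
  have "pf K (E i j) = 0" for i j
    using assms(2) wedge_bivector by blast
  from this [of i0 i1] this [of i0 i2] this [of i0 i3] this [of i1 i2] this [of i1 i3] this [of i2 i3]
  show ?thesis
    by (intro bivector_eqI) (simp_all add: assms(1) pf_def wedge_def axis_def neqs
      subspace_0 [OF subspace_bivectors])
qed

text \<open>Polarizes the Pfaffian analogue of the adjugate identity: \<open>star K\<close> times K
  is minus the Pfaffian of K times the identity.\<close>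

lemma star_mult_polar:
  assumes "K \<in> bivectors" "B \<in> bivectors"
  shows "star K *v (B *v h) + star B *v (K *v h) = - pf K B *\<^sub>R h"
  unfolding vec_eq_iff all4
  by (simp add: matrix_vector_mult_def sum4 bivector_entries [OF assms(1)] bivector_entries [OF assms(2)]
      bivector_entries [OF star_bivector] star_entries pf_def algebra_simps)

text \<open>Bivectors annihilated by h are lines in the plane h of projective 3-space, and any two
  coplanar lines meet.\<close>

lemma pf_common_kernel:
  assumes "K \<in> bivectors" "B \<in> bivectors" "K *v h = 0" "B *v h = 0" "h \<noteq> 0"
  shows "pf K B = 0"
  using star_mult_polar [OF assms(1,2), of h] assms(3-5) by simp

text \<open>The dual of the wedge of two covectors is the intersection of their planes, which lies
  in the plane h.\<close>

lemma star_wedge_kernel: "h v* star (wedge h s) = 0"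
  unfolding vec_eq_iff all4
  by (simp add: vector_matrix_mult_def sum4 bivector_entries [OF star_bivector] star_entries
      wedge_def algebra_simps)

text \<open>The map sending s to \<open>star (wedge h s)\<close> is adjoint to contraction with h,
  with respect to \<open>pf\<close> and the dot product.\<close>

lemma pf_star_wedge:
  assumes "B \<in> bivectors"
  shows "pf (star (wedge h s)) B = s \<bullet> (h v* B)"
  by (simp add: pf_def star_entries wedge_def inner_vec_def vector_matrix_mult_def sum4
      bivector_entries [OF assms] algebra_simps)

text \<open>Polarizing the vanishing on decomposable bivectors makes the form alternating in all
  four vectors; in dimension four it is therefore a multiple of the determinant, which
  \<open>pf\<close> expresses on bivectors.\<close>

lemma klein_form_pf:
  assumes "klein_form \<Omega>"
  obtains c where "c \<noteq> 0" "\<And>B C. B \<in> bivectors \<Longrightarrow> C \<in> bivectors \<Longrightarrow> bfs \<Omega> B C = c * pf B C"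
proof -
  define f where "f P V P' V' = bfs \<Omega> (wedge P V) (wedge P' V')" for P V P' V'
  have q: "qf \<Omega> (wedge P V) = 0" for P V
    using assms unfolding klein_form_def by blast
  have z1: "f P V P V' = 0" for P V V'
    using qf_add [of \<Omega> "wedge P V" "wedge P V'"] unfolding linear_add [OF linear_wedge, symmetric]
    by (simp add: q f_def)
  have s1: "f P V V' P' = - f P V P' V'" and s2: "f V P P' V' = - f P V P' V'" for P V P' V'
    by (simp_all add: f_def wedge_swap [of V' P'] wedge_swap [of V P] bfs_linear bfs_linear_left)
  have z2: "f P V V' P = 0" "f V P P V' = 0" "f V P V' P = 0" for P V V'
    using z1 [of P V V'] s1 [where P=P and V=V and P'=P and V'=V']
      s2 [where P=P and V=V and P'=P and V'=V'] s1 [where P=V and V=P and P'=P and V'=V']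
    by simp_all
  \<comment> \<open>Polarization of \<open>z1\<close> in P; this exchanges vectors from different
    bivectors.\<close>
  have x1: "f P V P' V' = - f P' V P V'" for P V P' V'
    using z1 [of "P + P'" V V'] z1 [of P V V'] z1 [of P' V V']
    by (simp add: f_def wedge_add_left bfs_linear bfs_linear_left)
  define c where "c = f (axis i0 1) (axis i1 1) (axis i2 1) (axis i3 1)"
  have c1: "f (axis i0 1) (axis i2 1) (axis i1 1) (axis i3 1) = - c"
    using x1 [of "axis i0 1" "axis i2 1" "axis i1 1" "axis i3 1"]
      s2 [where V="axis i1 1" and P="axis i2 1" and P'="axis i0 1" and V'="axis i3 1"]
      x1 [of "axis i2 1" "axis i1 1" "axis i0 1" "axis i3 1"]
    unfolding c_def by linarith
  have c2: "f (axis i0 1) (axis i3 1) (axis i1 1) (axis i2 1) = c"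
  proof -
    have "f P V P' V' = - f P V' P' V" for P V P' V'
      using x1 [of V P V' P'] s2 [where P=P and V=V and P'=V' and V'=P']
        s1 [where P=P and V=V and P'=P' and V'=V'] s2 [where P=P and V=V' and P'=V and V'=P']
        s1 [where P=P and V=V' and P'=P' and V'=V]
      by linarith
    from this [of "axis i0 1" "axis i3 1" "axis i1 1" "axis i2 1"] c1 show ?thesis
      by linarith
  qed
  have expand: "B = B $ i0 $ i1 *\<^sub>R E i0 i1 + B $ i0 $ i2 *\<^sub>R E i0 i2 + B $ i0 $ i3 *\<^sub>R E i0 i3
      + B $ i1 $ i2 *\<^sub>R E i1 i2 + B $ i1 $ i3 *\<^sub>R E i1 i3 + B $ i2 $ i3 *\<^sub>R E i2 i3"
    if "B \<in> bivectors" for B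
    unfolding vec_eq_iff all4
    by (simp add: bivector_entries [OF that] wedge_def axis_def neqs)
  have sym: "f P V P' V' = f P' V' P V" for P V P' V'
    by (simp add: f_def bfs_sym)
  note c = c_def [symmetric] c1 c2 sym [of "axis i2 1" _ "axis i0 1"] sym [of "axis i1 1" _ "axis i0 1"]
  have "bfs \<Omega> B C = c * pf B C" if B: "B \<in> bivectors" and C: "C \<in> bivectors" for B C
  proof -
    have e: "bfs \<Omega> (E i j) C = C $ i0 $ i1 * f (axis i 1) (axis j 1) (axis i0 1) (axis i1 1)
        + C $ i0 $ i2 * f (axis i 1) (axis j 1) (axis i0 1) (axis i2 1)
        + C $ i0 $ i3 * f (axis i 1) (axis j 1) (axis i0 1) (axis i3 1)
        + C $ i1 $ i2 * f (axis i 1) (axis j 1) (axis i1 1) (axis i2 1)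
        + C $ i1 $ i3 * f (axis i 1) (axis j 1) (axis i1 1) (axis i3 1)
        + C $ i2 $ i3 * f (axis i 1) (axis j 1) (axis i2 1) (axis i3 1)" for i j
      by (subst expand [OF C]) (simp add: bfs_linear f_def)
    have "bfs \<Omega> B C = B $ i0 $ i1 * bfs \<Omega> (E i0 i1) C + B $ i0 $ i2 * bfs \<Omega> (E i0 i2) C
        + B $ i0 $ i3 * bfs \<Omega> (E i0 i3) C + B $ i1 $ i2 * bfs \<Omega> (E i1 i2) C
        + B $ i1 $ i3 * bfs \<Omega> (E i1 i3) C + B $ i2 $ i3 * bfs \<Omega> (E i2 i3) C"
      by (subst expand [OF B]) (simp add: bfs_linear_left)
    then show ?thesis
      unfolding e by (simp add: z1 z2 c pf_def algebra_simps)
  qed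
  moreover from this have "c \<noteq> 0"
    using assms unfolding klein_form_def bfs_self [symmetric] by fastforce
  ultimately show ?thesis
    using that by blast
qed

text \<open>The operator with \<open>\<Omega>(T B, B') = S(\<iota>\<^sub>h B, \<iota>\<^sub>h B')\<close> is
  \<open>T B = star (h \<and> S \<iota>\<^sub>h B)\<close>; it squares to zero because \<open>\<iota>\<^sub>h\<close> kills its range.\<close>
lemma segre_222_contraction:
  fixes S :: "real^'m^'m" and h :: "real^'m"
  assumes h: "h \<noteq> 0" and S: "transpose S = S"
    and nondeg: "\<And>w. h \<bullet> w = 0 \<Longrightarrow> (\<And>u. h \<bullet> u = 0 \<Longrightarrow> u \<bullet> (S *v w) = 0) \<Longrightarrow> w = 0"
  shows "segre_222 (\<lambda>i j k l. h $ i * h $ k * S $ j $ l)" (is "segre_222 ?\<Phi>")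
proof -
  \<comment> \<open>Summing over ordered index pairs counts each coordinate twice, so a product of
    two coordinates appears with weight 4; the factor \<open>2 / 4\<close> makes
    \<open>bfs \<Omega>\<close> equal to \<open>pf\<close> on bivectors.\<close>
  define \<Omega> :: "'m \<Rightarrow> 'm \<Rightarrow> 'm \<Rightarrow> 'm \<Rightarrow> real" where "\<Omega> i j k l =
    2 * (E i0 i1 $ i $ j * E i2 i3 $ k $ l - E i0 i2 $ i $ j * E i1 i3 $ k $ l
      + E i0 i3 $ i $ j * E i1 i2 $ k $ l) / 4" for i j k l
  have bil\<Omega>: "bil \<Omega> B C = 2 * (B $ i0 $ i1 * C $ i2 $ i3 - B $ i0 $ i2 * C $ i1 $ i3
      + B $ i0 $ i3 * C $ i1 $ i2)" if B: "B \<in> bivectors" and C: "C \<in> bivectors" for B C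
  proof -
    have pair: "(\<Sum>i\<in>UNIV. \<Sum>j\<in>UNIV. E a b $ i $ j * X $ i $ j) = 2 * X $ a $ b"
      if "X \<in> bivectors" for a b X
    proof -
      have ax: "(\<Sum>i\<in>UNIV. axis c 1 $ i * y i) = y c" for c :: 'm and y :: "'m \<Rightarrow> real"
        by (simp add: axis_def if_distrib [where f = "\<lambda>x. x * _"] cong: if_cong)
      have "(\<Sum>i\<in>UNIV. \<Sum>j\<in>UNIV. E a b $ i $ j * X $ i $ j) =
        (\<Sum>i\<in>UNIV. axis a 1 $ i * (\<Sum>j\<in>UNIV. axis b 1 $ j * X $ i $ j)) -
        (\<Sum>i\<in>UNIV. axis b 1 $ i * (\<Sum>j\<in>UNIV. axis a 1 $ j * X $ i $ j))"
        unfolding sum_distrib_left sum_subtractf [symmetric]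
        by (intro sum.cong refl) (simp add: wedge_def algebra_simps)
      then have "(\<Sum>i\<in>UNIV. \<Sum>j\<in>UNIV. E a b $ i $ j * X $ i $ j) = X $ a $ b - X $ b $ a"
        unfolding ax .
      then show ?thesis
        using bivector_entry [OF that, of b a] by simp
    qed
    have prod: "(\<Sum>i\<in>UNIV. \<Sum>j\<in>UNIV. \<Sum>k\<in>UNIV. \<Sum>l\<in>UNIV.
        E a b $ i $ j * E c d $ k $ l * B $ i $ j * C $ k $ l) = 4 * (B $ a $ b * C $ c $ d)" for a b c d
    proof -
      have "(\<Sum>i\<in>UNIV. \<Sum>j\<in>UNIV. \<Sum>k\<in>UNIV. \<Sum>l\<in>UNIV.
          E a b $ i $ j * E c d $ k $ l * B $ i $ j * C $ k $ l) =
        (\<Sum>i\<in>UNIV. \<Sum>j\<in>UNIV. E a b $ i $ j * B $ i $ j)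
          * (\<Sum>k\<in>UNIV. \<Sum>l\<in>UNIV. E c d $ k $ l * C $ k $ l)"
        unfolding sum_distrib_right unfolding sum_distrib_left by (intro sum.cong refl) simp
      then show ?thesis
        by (simp add: pair B C)
    qed
    have "bil \<Omega> B C = ((\<Sum>i\<in>UNIV. \<Sum>j\<in>UNIV. \<Sum>k\<in>UNIV. \<Sum>l\<in>UNIV.
          E i0 i1 $ i $ j * E i2 i3 $ k $ l * B $ i $ j * C $ k $ l)
        - (\<Sum>i\<in>UNIV. \<Sum>j\<in>UNIV. \<Sum>k\<in>UNIV. \<Sum>l\<in>UNIV.
          E i0 i2 $ i $ j * E i1 i3 $ k $ l * B $ i $ j * C $ k $ l)
        + (\<Sum>i\<in>UNIV. \<Sum>j\<in>UNIV. \<Sum>k\<in>UNIV. \<Sum>l\<in>UNIV.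
          E i0 i3 $ i $ j * E i1 i2 $ k $ l * B $ i $ j * C $ k $ l)) / 2"
      unfolding bil_def \<Omega>_def sum_subtractf [symmetric] sum.distrib [symmetric] sum_divide_distrib
      by (intro sum.cong refl) (simp add: field_simps)
    then show ?thesis
      unfolding prod by simp
  qed
  have bfs\<Omega>: "bfs \<Omega> B C = pf B C" if "B \<in> bivectors" "C \<in> bivectors" for B C
    using that by (simp add: bfs_bil bil\<Omega> pf_def)
  have "klein_form \<Omega>"
    unfolding klein_form_def
  proof (intro conjI allI)
    show "qf \<Omega> (wedge P V) = 0" for P V
      by (simp add: bfs_self [symmetric] bfs\<Omega> wedge_bivector pf_wedge)
    \<comment> \<open>The sum of two skew lines is not decomposable, so the form does not vanish
      there.\<close>
    let ?B = "E i0 i1 + E i2 i3"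
    have B: "?B \<in> bivectors"
      by (intro subspace_add subspace_bivectors wedge_bivector)
    have "qf \<Omega> ?B = 2"
      unfolding bfs_self [symmetric] bfs\<Omega> [OF B B]
      by (simp add: pf_def wedge_def axis_def neqs)
    with B show "\<exists>B\<in>bivectors. qf \<Omega> B \<noteq> 0"
      by (intro bexI [of _ ?B]) simp_all
  qed
  define L where "L w = star (wedge h (S *v w))" for w
  define T where "T B = L (h v* B)" for B
  have linL: "linear L"
    unfolding L_def
    by (rule linearI) (simp_all add: matrix_vector_right_distrib matrix_vector_mult_scaleR
      linear_add [OF linear_wedge] linear_scale [OF linear_wedge]
      linear_add [OF linear_star] linear_scale [OF linear_star])
  have linc: "linear (\<lambda>B. h v* B)"
    by (rule linearI) (simp_all add: vec_eq_iff vector_matrix_mult_def sum.distrib distrib_left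
        sum_distrib_left mult.left_commute)
  have linT: "linear T"
    using linear_compose [OF linc linL] by (simp add: T_def [abs_def] o_def)
  have Tbiv: "T B \<in> bivectors" for B
    by (simp add: T_def L_def star_bivector)
  have TT: "T (T B) = 0" for B
    unfolding T_def by (simp add: L_def star_wedge_kernel linear_0 [OF linear_star])
  have T: "bfs \<Omega> (T B) C = bfs ?\<Phi> B C" if "C \<in> bivectors" for B C
    using that by (simp add: bfs\<Omega> Tbiv bfs_contraction [OF S]) 
      (simp add: T_def L_def pf_star_wedge, metis S dot_transpose_mult inner_commute)
  \<comment> \<open>T is L after contraction, and contraction maps onto the three-dimensional
    hyperplane; the rank is 3 once L is injective there.\<close>
  have image: "(\<lambda>B. h v* B) ` bivectors = {w. h \<bullet> w = 0}"
  proof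
    show "(\<lambda>B. h v* B) ` bivectors \<subseteq> {w. h \<bullet> w = 0}"
      by (auto simp: vector_mult_bivector_orthogonal)
    show "{w. h \<bullet> w = 0} \<subseteq> (\<lambda>B. h v* B) ` bivectors"
    proof
      fix w assume "w \<in> {w. h \<bullet> w = 0}"
      then have "w = h v* wedge h ((1 / (h \<bullet> h)) *\<^sub>R w)"
        using h by (simp add: vector_mult_wedge)
      then show "w \<in> (\<lambda>B. h v* B) ` bivectors"
        using wedge_bivector by blast
    qed
  qed
  have inj: "w = 0" if w: "h \<bullet> w = 0" and "L w = 0" for w
  proof (rule nondeg [OF w])
    fix u assume u: "h \<bullet> u = 0"
    \<comment> \<open>Then \<open>S *v w\<close> is parallel to h, hence orthogonal to the
      hyperplane, and the nondegeneracy of S on the hyperplane applies.\<close>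
    have "wedge h (S *v w) = 0"
      using \<open>L w = 0\<close> star_star [OF wedge_bivector, of h "S *v w"]
      by (simp add: L_def linear_0 [OF linear_star])
    then have "h v* wedge h (S *v w) = 0"
      by (simp add: linear_0 [OF linc])
    then have "((h \<bullet> h) *\<^sub>R (S *v w) - (h \<bullet> (S *v w)) *\<^sub>R h) \<bullet> u = 0"
      unfolding vector_mult_wedge by simp
    then have "u \<bullet> ((h \<bullet> h) *\<^sub>R (S *v w) - (h \<bullet> (S *v w)) *\<^sub>R h) = 0"
      by (simp only: inner_commute)
    then show "u \<bullet> (S *v w) = 0"
      using h u by (simp add: inner_diff_right inner_commute [of u h])
  qed
  have sub: "subspace {w. h \<bullet> w = 0}"
    by (rule subspace_hyperplane)
  have "inj_on L {w. h \<bullet> w = 0}"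
    unfolding linear_injective_on_subspace_0 [OF linL sub]
  proof (intro ballI impI)
    fix w assume "w \<in> {w. h \<bullet> w = 0}" "L w = 0"
    then show "w = 0" by (intro inj) simp_all
  qed
  then have "inj_on L (span {w. h \<bullet> w = 0})"
    unfolding span_eq_iff [THEN iffD2, OF sub] .
  then have "dim (L ` {w. h \<bullet> w = 0}) = dim {w. h \<bullet> w = 0}"
    by (rule dim_image_eq [OF linL])
  also have "\<dots> = 3"
    using dim_hyperplane [OF h] by (simp add: card4)
  finally have "dim (T ` bivectors) = 3"
    unfolding image [symmetric] image_image T_def .
  then show ?thesis
    unfolding segre_222_def
    \<comment> \<open>The form is already \<open>bfs \<Omega> (T B) C\<close>, so the eigenvalue is
      0.\<close>
    by (intro exI [of _ \<Omega>] exI [of _ 0] exI [of _ T] conjI ballI image_subsetI)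
      (simp_all only: \<open>klein_form \<Omega>\<close> linT Tbiv TT T mult_zero_left diff_zero)
qed

section \<open>From Segre symbol [(222)] to a fixed hyperplane\<close>

lemma star_mult:
  assumes "K \<in> bivectors" "P $ i0 = 1"
  shows "K $ i2 $ i3 = P $ i2 * K $ i0 $ i3 - P $ i3 * K $ i0 $ i2 - (star K *v P) $ i1"
    "K $ i1 $ i3 = P $ i1 * K $ i0 $ i3 - P $ i3 * K $ i0 $ i1 + (star K *v P) $ i2"
    "K $ i1 $ i2 = P $ i1 * K $ i0 $ i2 - P $ i2 * K $ i0 $ i1 - (star K *v P) $ i3"
  by (simp_all add: matrix_vector_mult_def sum4 bivector_entries [OF star_bivector] star_entries
      assms algebra_simps)

text \<open>A bivector is determined by its \<open>i0\<close> row and the vector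
  \<open>star K *v P\<close>; in these coordinates \<open>pf\<close> is minus the natural pairing of
  the two halves.\<close>

lemma pf_star_mult:
  assumes "K \<in> bivectors" "B \<in> bivectors" "P $ i0 = 1"
  shows "pf K B = - (K $ i0 $ i1 * (star B *v P) $ i1 + K $ i0 $ i2 * (star B *v P) $ i2
    + K $ i0 $ i3 * (star B *v P) $ i3 + B $ i0 $ i1 * (star K *v P) $ i1
    + B $ i0 $ i2 * (star K *v P) $ i2 + B $ i0 $ i3 * (star K *v P) $ i3)"
  unfolding pf_def star_mult [OF assms(1,3)] star_mult [OF assms(2,3)] by (simp add: algebra_simps)

text \<open>A three-dimensional isotropic space of bivectors is either the plane of all lines through a
  point or the plane of all lines in a hyperplane. Being transversal to the plane of lines
  through P rules out the first kind. The space is then a graph over its values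
  \<open>star K *v P\<close>, and isotropy makes the graph map skew; its three entries give h.\<close>
lemma isotropic_common_kernel:
  fixes W :: "(real^'m^'m) set"
  assumes W: "subspace W" "W \<subseteq> bivectors" "dim W = 3"
    and iso: "\<And>K B. K \<in> W \<Longrightarrow> B \<in> W \<Longrightarrow> pf K B = 0"
    and P: "P $ i0 = 1" and transversal: "\<And>K. K \<in> W \<Longrightarrow> star K *v P = 0 \<Longrightarrow> K = 0"
  obtains h where "h \<noteq> 0" "\<And>K. K \<in> W \<Longrightarrow> K *v h = 0"
proof -
  define \<psi> where "\<psi> K = star K *v P" for K
  have lin: "linear \<psi>"
    unfolding \<psi>_def
    by (rule linearI) (simp_all add: linear_add [OF linear_star] linear_scale [OF linear_star]
      matrix_vector_mult_add_rdistrib scaleR_matrix_vector_assoc)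
  have P0: "P \<noteq> 0" using P by auto
  have spanW: "span W = W"
    using W(1) span_eq_iff by blast
  \<comment> \<open>Transversality is injectivity of \<open>\<psi>\<close> on W, and skewness of
    \<open>star K\<close> puts its values in the orthogonal complement of P. Equal dimensions make W
    a graph over this complement.\<close>
  have "inj_on \<psi> (span W)"
    using transversal W(1) by (simp add: linear_injective_on_subspace_0 [OF lin] spanW \<psi>_def)
  then have "dim (\<psi> ` W) = 3"
    using dim_image_eq [OF lin] W(3) by metis
  moreover have "\<psi> ` W \<subseteq> {w. P \<bullet> w = 0}"
    by (auto simp: \<psi>_def bivector_inner_self [OF star_bivector])
  moreover have "dim {w. P \<bullet> w = 0} = 3"
    using dim_hyperplane [OF P0] by (simp add: card4)
  ultimately have range: "\<psi> ` W = {w. P \<bullet> w = 0}"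
    by (intro subspace_dim_equal linear_subspace_image [OF lin W(1)] subspace_hyperplane) simp_all
  have "\<exists>K\<in>W. \<psi> K = axis i 1 - P $ i *\<^sub>R axis i0 1" for i
  proof -
    have "axis i 1 - P $ i *\<^sub>R axis i0 1 \<in> {w. P \<bullet> w = 0}"
      by (simp add: inner_diff_right inner_axis P)
    then show ?thesis
      unfolding range [symmetric] by auto
  qed
  then obtain D where D: "\<And>i. D i \<in> W" "\<And>i. star (D i) *v P = axis i 1 - P $ i *\<^sub>R axis i0 1"
    unfolding \<psi>_def by metis
  define r where "r i j = D i $ i0 $ j" for i j
  have biv: "K \<in> bivectors" if "K \<in> W" for K
    using W(2) that by blast
  \<comment> \<open>Isotropy against \<open>D i\<close> expresses the \<open>i0\<close> row of K
    through \<open>star K *v P\<close>, and applied to \<open>K = D j\<close> it shows that r is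
    skew.\<close>
  have K: "r i i1 * (star K *v P) $ i1 + r i i2 * (star K *v P) $ i2 + r i i3 * (star K *v P) $ i3
      = - K $ i0 $ i" if "K \<in> W" and i: "i \<in> {i1, i2, i3}" for K i
    using iso [OF D(1) that(1), of i] i
    unfolding pf_star_mult [OF biv [OF D(1)] biv [OF that(1)] P] D(2)
    by (auto simp: axis_def neqs r_def)
  have rr: "r i j = - r j i" if "i \<in> {i1, i2, i3}" "j \<in> {i1, i2, i3}" for i j
    using K [OF D(1) that(1), of j] that unfolding D(2) by (auto simp: axis_def neqs r_def)
  define \<alpha> where "\<alpha> = r i1 i2"
  define \<beta> where "\<beta> = r i1 i3"
  define \<gamma> where "\<gamma> = r i2 i3"
  have r: "r i1 i1 = 0" "r i2 i2 = 0" "r i3 i3 = 0" "r i1 i2 = \<alpha>" "r i1 i3 = \<beta>" "r i2 i3 = \<gamma>"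
      "r i2 i1 = - \<alpha>" "r i3 i1 = - \<beta>" "r i3 i2 = - \<gamma>"
    using rr [of i1 i1] rr [of i2 i2] rr [of i3 i3] rr [of i2 i1] rr [of i3 i1] rr [of i3 i2]
    by (simp_all add: \<alpha>_def \<beta>_def \<gamma>_def)
  \<comment> \<open>The entries at \<open>i1\<close>, \<open>i2\<close>, \<open>i3\<close> form the
    axial vector of the skew matrix r; the entry at \<open>i0\<close> is chosen so that
    \<open>h \<bullet> P = - 1\<close>, hence h is nonzero.\<close>
  define h where "h = (- 1 - P $ i1 * \<gamma> + P $ i2 * \<beta> - P $ i3 * \<alpha>) *\<^sub>R axis i0 1
    + \<gamma> *\<^sub>R axis i1 1 - \<beta> *\<^sub>R axis i2 1 + \<alpha> *\<^sub>R axis i3 (1::real)"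
  have h: "h $ i0 = - 1 - P $ i1 * \<gamma> + P $ i2 * \<beta> - P $ i3 * \<alpha>" "h $ i1 = \<gamma>" "h $ i2 = - \<beta>" "h $ i3 = \<alpha>"
    by (simp_all add: h_def axis_def neqs)
  have "h \<bullet> P = - 1"
    by (simp add: inner_vec_def sum4 h P algebra_simps)
  then have "h \<noteq> 0" by auto
  moreover have "K *v h = 0" if KW: "K \<in> W" for K
  proof -
    define w where "w i = (star K *v P) $ i" for i
    have k: "K $ i0 $ i1 = - (\<alpha> * w i2 + \<beta> * w i3)" "K $ i0 $ i2 = \<alpha> * w i1 - \<gamma> * w i3"
        "K $ i0 $ i3 = \<beta> * w i1 + \<gamma> * w i2"
      using K [OF KW, of i1] K [OF KW, of i2] K [OF KW, of i3] by (simp_all add: r w_def)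
    note k' = star_mult [OF biv [OF KW] P, folded w_def, unfolded k]
    show ?thesis
      unfolding vec_eq_iff all4
      by (simp add: matrix_vector_mult_def sum4 bivector_entries [OF biv [OF KW]] k k' h algebra_simps)
  qed
  ultimately show ?thesis
    using that by blast
qed

text \<open>On lines \<open>\<Phi>\<close> agrees with \<open>\<Phi> - lam0 \<Omega>\<close>, the
  form given by T, since \<open>\<Omega>\<close> vanishes there. This form factors through
  contraction with h, where h is the common kernel of the range of T.\<close>

lemma segre_222_cone:
  assumes segre: "segre_222 \<Phi>" and P: "P $ i0 = 1"
    and nondeg: "\<And>V. V $ i0 = 0 \<Longrightarrow> (\<And>V'. bfs \<Phi> (wedge P V) (wedge P V') = 0) \<Longrightarrow> V = 0"
  obtains h S where "h \<noteq> 0" "\<And>P V. qf \<Phi> (wedge P V) = (h v* wedge P V) \<bullet> (S *v (h v* wedge P V))"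
proof -
  obtain \<Omega> lam0 and T :: "real^'m^'m \<Rightarrow> real^'m^'m"
    where klein: "klein_form \<Omega>" and linT: "linear T" and Tbiv: "T ` bivectors \<subseteq> bivectors"
      and T: "\<And>B C. B \<in> bivectors \<Longrightarrow> C \<in> bivectors \<Longrightarrow> bfs \<Omega> (T B) C = bfs \<Phi> B C - lam0 * bfs \<Omega> B C"
      and TT: "\<And>B. B \<in> bivectors \<Longrightarrow> T (T B) = 0" and dimT: "dim (T ` bivectors) = 3"
    using segre unfolding segre_222_def by metis
  obtain c where c: "c \<noteq> 0" "\<And>B C. B \<in> bivectors \<Longrightarrow> C \<in> bivectors \<Longrightarrow> bfs \<Omega> B C = c * pf B C"
    using klein_form_pf [OF klein] by metis
  define \<beta> where "\<beta> B C = bfs \<Phi> B C - lam0 * bfs \<Omega> B C" for B C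
  have \<beta>: "\<beta> B C = c * pf (T B) C" if "B \<in> bivectors" "C \<in> bivectors" for B C
    using T [OF that] c(2) [of "T B" C] that Tbiv by (auto simp: \<beta>_def)
  have \<beta>_sym: "\<beta> B C = \<beta> C B" for B C
    by (simp add: \<beta>_def bfs_sym)
  have \<beta>_linear: "linear (\<beta> B)" for B
    unfolding \<beta>_def by (rule linearI) (simp_all add: bfs_linear algebra_simps)
  have q0: "qf \<Omega> (wedge Q V) = 0" for Q V
    using klein unfolding klein_form_def by blast
  have \<Omega>0: "bfs \<Omega> (wedge Q V) (wedge Q V') = 0" for Q V V'
    using qf_add [of \<Omega> "wedge Q V" "wedge Q V'"] unfolding linear_add [OF linear_wedge, symmetric]
    by (simp add: q0)
  have T0: "T 0 = 0"
    by (rule linear_0 [OF linT])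
  have b0: "0 \<in> bivectors"
    by (rule subspace_0 [OF subspace_bivectors])
  \<comment> \<open>T is self-adjoint for \<open>pf\<close>, so isotropy of its range follows from
    \<open>T (T B) = 0\<close>.\<close>
  have iso: "pf K C = 0" if K: "K \<in> T ` bivectors" and C: "C \<in> T ` bivectors" for K C
  proof -
    obtain A B where A: "A \<in> bivectors" "K = T A" and B: "B \<in> bivectors" "C = T B"
      using K C by blast
    have C: "C \<in> bivectors" using B Tbiv by blast
    have "c * pf K C = \<beta> C A"
      using \<beta> [OF A(1) C] \<beta>_sym A(2) by simp
    also have "\<dots> = 0"
      using \<beta> [OF C A(1)] TT [OF B(1)] B(2) by simp
    finally show ?thesis using c(1) by simp
  qed
  \<comment> \<open>Such a K is a line through P. Lying in the range of T it is killed by T, so it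
    is in the kernel of the form on lines through P.\<close>
  have transversal: "K = 0" if K: "K \<in> T ` bivectors" and K0: "star K *v P = 0" for K
  proof -
    have Kb: "K \<in> bivectors" using K Tbiv by blast
    have KV: "K = wedge P (K $ i0)"
      using star_mult [OF Kb P]
      by (intro bivector_eqI Kb wedge_bivector)
        (simp_all add: K0 wedge_def P bivector_entries [OF Kb])
    have "T K = 0"
      using K TT by blast
    have "bfs \<Phi> K (wedge P V') = 0" for V'
    proof -
      have "\<beta> K (wedge P V') = 0"
        using \<beta> [OF Kb wedge_bivector] \<open>T K = 0\<close> by simp
      then show ?thesis
        using \<Omega>0 [of P "K $ i0" V'] unfolding KV [symmetric] \<beta>_def by simp
    qed
    then have "bfs \<Phi> (wedge P (K $ i0)) (wedge P V') = 0" for V'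
      unfolding KV [symmetric] .
    then have "K $ i0 = 0"
      by (intro nondeg) (simp_all add: bivector_entries [OF Kb])
    then show "K = 0"
      using KV by simp
  qed
  obtain h where h: "h \<noteq> 0" and ker: "\<And>K. K \<in> T ` bivectors \<Longrightarrow> K *v h = 0"
    using isotropic_common_kernel [OF linear_subspace_image [OF linT subspace_bivectors] Tbiv dimT iso P
        transversal] by metis
  \<comment> \<open>By self-adjointness \<open>pf (T B) C\<close> equals \<open>pf (T C) B\<close>,
    and both \<open>T C\<close> and B are annihilated by h.\<close>
  have T_ker: "T B = 0" if B: "B \<in> bivectors" and Bh: "B *v h = 0" for B
  proof (rule pf_nondegenerate)
    show "T B \<in> bivectors" using B Tbiv by blast
    fix C :: "real^'m^'m" assume C: "C \<in> bivectors"
    have "c * pf (T B) C = \<beta> C B"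
      using \<beta> [OF B C] \<beta>_sym by simp
    also have "\<dots> = c * pf (T C) B"
      by (rule \<beta> [OF C B])
    also have "pf (T C) B = 0"
      using C Tbiv B ker Bh h by (intro pf_common_kernel [of _ _ h]) auto
    finally show "pf (T B) C = 0"
      using c(1) by simp
  qed
  define f where "f w w' = \<beta> (wedge h w) (wedge h w') / (h \<bullet> h)^2" for w w'
  have lin1: "linear (f w)" for w
    unfolding f_def
    by (rule linearI) (simp_all add: linear_add [OF linear_wedge] linear_scale [OF linear_wedge]
      linear_add [OF \<beta>_linear] linear_scale [OF \<beta>_linear] add_divide_distrib)
  have f_sym: "f w w' = f w' w" for w w'
    by (simp add: f_def \<beta>_sym)
  have "linear (\<lambda>w. f w w')" for w'
    using lin1 [of w'] by (subst f_sym)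
  then obtain S where S: "\<And>w w'. f w w' = w \<bullet> (S *v w')"
    using bilinear_form_matrix [of f] lin1 by blast
  have \<beta>_f: "\<beta> B B = f (h v* B) (h v* B)" if B: "B \<in> bivectors" for B
  proof -
    \<comment> \<open>R is rebuilt from \<open>h v* B\<close> alone and has the same contraction as
      B, so \<open>B - R\<close> is in the kernel of T. The scaling accounts for the divisor in
      f.\<close>
    define R where "R = (1 / (h \<bullet> h)) *\<^sub>R wedge h (h v* B)"
    have R: "R \<in> bivectors"
      unfolding R_def by (intro subspace_scale subspace_bivectors wedge_bivector)
    have BR: "B - R \<in> bivectors"
      by (intro subspace_diff subspace_bivectors B R)
    have "R *v h = B *v h"
    proof -
      have "R *v h = - (1 / (h \<bullet> h)) *\<^sub>R (h v* wedge h (h v* B))"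
        by (simp add: R_def scaleR_matrix_vector_assoc [symmetric] vector_mult_bivector [OF wedge_bivector])
      also have "\<dots> = - (h v* B)"
        using h by (simp add: vector_mult_wedge vector_mult_bivector_orthogonal [OF B])
      finally show ?thesis
        by (simp add: vector_mult_bivector [OF B])
    qed
    then have "T (B - R) = 0"
      by (intro T_ker BR) (simp add: matrix_vector_mult_diff_rdistrib)
    then have z: "\<beta> C (B - R) = 0" if "C \<in> bivectors" for C
      using \<beta> [OF BR that] by (simp add: \<beta>_sym [of C])
    have "\<beta> B B = \<beta> B R"
      using z [OF B] by (simp add: linear_diff [OF \<beta>_linear])
    also have "\<dots> = \<beta> R R"
      using z [OF R] by (simp add: linear_diff [OF \<beta>_linear] \<beta>_sym [of B R])
    also have "\<dots> = f (h v* B) (h v* B)"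
      by (simp add: R_def f_def linear_scale [OF \<beta>_linear] \<beta>_sym [of "_ *\<^sub>R _" "wedge _ _"]
        power2_eq_square)
    finally show ?thesis .
  qed
  have "qf \<Phi> (wedge Q V) = (h v* wedge Q V) \<bullet> (S *v (h v* wedge Q V))" for Q V
    using \<beta>_f [OF wedge_bivector, of Q V] by (simp add: S \<beta>_def bfs_self q0)
  then show ?thesis
    using that h by blast
qed

end

section \<open>The case n = 3\<close>

text \<open>Polarizing the invariance under translation by v shows that v is in the kernel of
  F.\<close>

lemma form_kernel_trivial:
  fixes F :: "real^'n^'n"
  assumes "transpose F = F" "det F \<noteq> 0" "v \<bullet> (F *v v) = 0"
    and "\<And>u. (v + u) \<bullet> (F *v (v + u)) = u \<bullet> (F *v u)"
  shows "v = 0"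
proof -
  have "v \<bullet> (F *v u) = 0" for u
    using quadratic_polar [OF assms(1), of v u] assms(3) assms(4) [of u] by simp
  then have "u \<bullet> (F *v v) = 0" for u
    by (metis assms(1) dot_transpose_mult inner_commute)
  then have "F *v v = 0"
    by (metis inner_eq_zero_iff)
  then show ?thesis
    using assms(2) det_nz_iff_ker by blast
qed

lemma cones_iff_null_complex:
  fixes U :: "(real^'n) set" and F :: "real^'n \<Rightarrow> real^'n^'n"
  assumes card: "CARD('n) = 3" and ne: "U \<noteq> {}"
    and sym: "\<forall>p\<in>U. transpose (F p) = F p" and det: "\<forall>p\<in>U. det (F p) \<noteq> 0"
  shows "cones_through_quadric U F \<longleftrightarrow> null_quadratic_complex_222 U F"
proof -
  obtain a b c :: 'n where abc: "UNIV = {a, b, c}" "a \<noteq> b" "b \<noteq> c" "a \<noteq> c"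
    using card unfolding card_3_iff by blast
  \<comment> \<open>With \<open>None\<close> as \<open>i0\<close>, every \<open>hom p\<close>
    satisfies the normalization \<open>P $ i0 = 1\<close>.\<close>
  interpret four_indices "None :: 'n option" "Some a" "Some b" "Some c"
    using abc by unfold_locales (auto simp: UNIV_option_conv)
  obtain p0 where p0: "p0 \<in> U" using ne by blast
  show ?thesis
  proof
    assume "cones_through_quadric U F"
    then obtain h S0 where h: "h \<noteq> 0" and l: "\<forall>p\<in>U. h \<bullet> hom p \<noteq> 0"
      and F0: "\<forall>p\<in>U. \<exists>\<mu>. \<mu> \<noteq> 0 \<and> (\<forall>v. v \<bullet> (F p *v v) = \<mu> * (proj_hyp h p v \<bullet> (S0 *v proj_hyp h p v)))"
      unfolding cones_through_quadric_def by blast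
    obtain S where S: "transpose S = S" "\<And>x. x \<bullet> (S *v x) = x \<bullet> (S0 *v x)"
      using symmetrization by blast
    let ?\<Phi> = "\<lambda>i j k l. h $ i * h $ k * S $ j $ l"
    have "segre_222 ?\<Phi>"
    proof (rule segre_222_contraction [OF h S(1)])
      fix w assume w: "h \<bullet> w = 0" and ort: "\<And>u. h \<bullet> u = 0 \<Longrightarrow> u \<bullet> (S *v w) = 0"
      have l0: "h \<bullet> hom p0 \<noteq> 0" using l p0 by blast
      obtain \<mu> where \<mu>: "\<And>v. v \<bullet> (F p0 *v v) = \<mu> * (proj_hyp h p0 v \<bullet> (S *v proj_hyp h p0 v))"
        using F0 p0 S(2) by metis
      obtain v where v: "w = proj_hyp h p0 v"
        using proj_hyp_surj [OF l0 w] .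
      have proj: "h \<bullet> proj_hyp h p0 u = 0" for u
        using l0 by (simp add: proj_hyp_def inner_diff_right)
      have uSw: "proj_hyp h p0 u \<bullet> (S *v w) = 0" for u
        by (rule ort [OF proj])
      \<comment> \<open>S inherits nondegeneracy on the hyperplane from \<open>F p0\<close>, because
        the projection from \<open>hom p0\<close> maps onto it.\<close>
      have "v = 0"
      proof (rule form_kernel_trivial [of "F p0"])
        show "v \<bullet> (F p0 *v v) = 0"
          using uSw [of v] by (simp add: \<mu> v)
        show "(v + u) \<bullet> (F p0 *v (v + u)) = u \<bullet> (F p0 *v u)" for u
        proof -
          have "w \<bullet> (S *v proj_hyp h p0 u) = 0"
            using uSw [of u] by (metis S(1) dot_transpose_mult inner_commute)
          moreover have "w \<bullet> (S *v w) = 0"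
            using uSw [of v] v by simp
          ultimately show ?thesis
            by (simp add: \<mu> linear_add [OF linear_proj_hyp] v [symmetric] quadratic_polar [OF S(1)])
        qed
      qed (use sym det p0 in auto)
      then show "w = 0"
        by (simp add: v linear_0 [OF linear_proj_hyp])
    qed
    moreover have "\<exists>\<mu>. \<mu> \<noteq> 0 \<and> (\<forall>v. v \<bullet> (F p *v v) = \<mu> * qf ?\<Phi> (wedge (hom p) (dirv v)))"
      if p: "p \<in> U" for p
    proof -
      have lp: "h \<bullet> hom p \<noteq> 0" using l p by blast
      obtain \<mu> where \<mu>: "\<mu> \<noteq> 0" "\<And>v. v \<bullet> (F p *v v) = \<mu> * (proj_hyp h p v \<bullet> (S *v proj_hyp h p v))"
        using F0 p S(2) by metis
      then show ?thesis
        using lp by (intro exI [of _ "\<mu> / (h \<bullet> hom p)^2"])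
          (simp add: qf_contraction_wedge [OF S(1) lp])
    qed
    ultimately show "null_quadratic_complex_222 U F"
      unfolding null_quadratic_complex_222_def by blast
  next
    assume "null_quadratic_complex_222 U F"
    then obtain \<Phi> where segre: "segre_222 \<Phi>"
      and F\<Phi>: "\<forall>p\<in>U. \<exists>\<mu>. \<mu> \<noteq> 0 \<and> (\<forall>v. v \<bullet> (F p *v v) = \<mu> * qf \<Phi> (wedge (hom p) (dirv v)))"
      unfolding null_quadratic_complex_222_def by blast
    have nondeg: "V = 0" if V: "V $ None = 0"
      and ort: "\<And>V'. bfs \<Phi> (wedge (hom p0) V) (wedge (hom p0) V') = 0" for V
    proof -
      obtain v where v: "V = dirv v" using dirv_eqI [OF V] by blast
      obtain \<mu> where \<mu>: "\<And>v. v \<bullet> (F p0 *v v) = \<mu> * qf \<Phi> (wedge (hom p0) (dirv v))"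
        using F\<Phi> p0 by blast
      have q: "qf \<Phi> (wedge (hom p0) V) = 0"
        using ort [of V] by (simp add: bfs_self)
      have "v = 0"
        by (rule form_kernel_trivial [of "F p0"])
          (use sym det p0 in \<open>simp_all add: \<mu> linear_add [OF linear_dirv] linear_add [OF linear_wedge]
            qf_add v [symmetric] q ort\<close>)
      then show ?thesis using v by simp
    qed
    obtain h S where h: "h \<noteq> 0"
      and qS: "\<And>P V. qf \<Phi> (wedge P V) = (h v* wedge P V) \<bullet> (S *v (h v* wedge P V))"
      using segre_222_cone [OF segre, of "hom p0"] nondeg by (metis hom_None)
    have "h \<bullet> hom p \<noteq> 0 \<and> (\<exists>\<mu>. \<mu> \<noteq> 0 \<and>
        (\<forall>v. v \<bullet> (F p *v v) = \<mu> * (proj_hyp h p v \<bullet> (S *v proj_hyp h p v))))" if p: "p \<in> U" for p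
    proof -
      obtain \<mu> where \<mu>: "\<mu> \<noteq> 0" "\<And>v. v \<bullet> (F p *v v) = \<mu> * qf \<Phi> (wedge (hom p) (dirv v))"
        using F\<Phi> p by blast
      have lp: "h \<bullet> hom p \<noteq> 0"
      proof
        \<comment> \<open>For a point on the hyperplane, contraction sends its lines to multiples of
          the point itself, so the form at p would have rank at most one. A direction v in the
          hyperplane then contradicts nondegeneracy.\<close>
        assume hp: "h \<bullet> hom p = 0"
        have Fv: "v \<bullet> (F p *v v) = \<mu> * ((h \<bullet> dirv v)^2 * (hom p \<bullet> (S *v hom p)))" for v
          by (simp add: \<mu> qS vector_mult_wedge hp matrix_vector_mult_scaleR power2_eq_square
              vec.neg linear_neg [OF matrix_vector_mul_linear])
        obtain v where v: "v \<noteq> 0" "orthogonal (\<chi> k. h $ Some k) v"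
          using orthogonal_to_vector_exists [of "\<chi> k. h $ Some k"] card by auto
        then have hv: "h \<bullet> dirv v = 0"
          by (simp add: orthogonal_def inner_vec_def sum_option)
        have "v = 0"
          by (rule form_kernel_trivial [of "F p"])
            (use sym det p in \<open>simp_all add: Fv hv linear_add [OF linear_dirv] inner_add_right\<close>)
        then show False using v by blast
      qed
      have "v \<bullet> (F p *v v) = \<mu> * (h \<bullet> hom p)^2 * (proj_hyp h p v \<bullet> (S *v proj_hyp h p v))" for v
      proof -
        have "h v* wedge (hom p) (dirv v) = (h \<bullet> hom p) *\<^sub>R proj_hyp h p v"
          using lp by (simp add: vector_mult_wedge proj_hyp_def scaleR_diff_right)
        then show ?thesis
          by (simp add: \<mu> qS matrix_vector_mult_scaleR power2_eq_square)
      qed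
      then show ?thesis
        using lp \<mu>(1) by (intro conjI exI [of _ "\<mu> * (h \<bullet> hom p)^2"]) auto
    qed
    then show "cones_through_quadric U F"
      unfolding cones_through_quadric_def using h by blast
  qed
qed

theorem theorem4:
  fixes U :: "(real^'n) set" and F :: "real^'n \<Rightarrow> real^'n^'n"
  assumes "CARD('n) \<ge> 2"
    and "open U" and "U \<noteq> {}"
    and "\<forall>p\<in>U. transpose (F p) = F p"
    and "\<forall>p\<in>U. det (F p) \<noteq> 0"
  shows "(linearizable U F \<longleftrightarrow> lagrangian_QL U F)
       \<and> (lagrangian_QL U F \<longleftrightarrow> cones_through_quadric U F)
       \<and> (CARD('n) = 3 \<longrightarrow> (linearizable U F \<longleftrightarrow> null_quadratic_complex_222 U F))"
  using linearizable_iff_cones [OF assms(4,5)] lagrangian_QL_iff_cones [OF assms(3-5)]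
    cones_iff_null_complex [OF _ assms(3-5)]
  by blast

end
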